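(* Let $\theta\in\mathbf{R}\setminus\mathbf{Q}$ and let $\gamma\in\mathbf{R}$. Let $\alpha\in\mathrm{Aut}(A_\theta)$ be an automorphism such that $\alpha(u)=e^{2\pi i\gamma}u$. Then there exist $d\in\mathbf{Z}$ and a continuous function $f\colon S^1\to\mathbf{R}$ such that $\alpha=\alpha_{\theta,\gamma,d,f}$.
   Context: For $\theta \in \mathbf{R}$, $A_\theta$ denotes the rotation algebra, the universal C*-algebra generated by unitaries $u$ and $v$ satisfying $vu = e^{2\pi i\theta}uv$. For $\theta,\gamma\in\mathbf{R}$, $d\in\mathbf{Z}$ and $f\colon S^1\to\mathbf{R}$ continuous, $\alpha_{\theta,\gamma,d,f}$ is the (unique) automorphism of $A_\theta$ such that $\alpha_{\theta,\gamma,d,f}(u) = e^{2\pi i\gamma}u$ and $\alpha_{\theta,\gamma,d,f}(v) = \exp(2\pi i f(u))u^d v$. *)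

theory Defs
  imports "HOL-Analysis.Analysis" "HOL-Algebra.Ring"
begin

section \<open>C*-algebras on a type\<close>

text \<open>The algebras are unital and, by the norm of \<open>1\<close> in the class
  \<^class>\<open>real_normed_algebra_1\<close>, nonzero.\<close>

class cstar_algebra = real_normed_algebra_1 + banach +
  fixes scaleC :: "complex \<Rightarrow> 'a \<Rightarrow> 'a"  (infixr \<open>*\<^sub>C\<close> 75)
    and adj :: "'a \<Rightarrow> 'a"
  assumes scaleC_add_right: "a *\<^sub>C (x + y) = a *\<^sub>C x + a *\<^sub>C y"
    and scaleC_add_left: "(a + b) *\<^sub>C x = a *\<^sub>C x + b *\<^sub>C x"
    and scaleC_scaleC: "a *\<^sub>C b *\<^sub>C x = (a * b) *\<^sub>C x"
    and scaleR_scaleC: "r *\<^sub>R x = complex_of_real r *\<^sub>C x"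
    and scaleC_mult_left: "(a *\<^sub>C x) * y = a *\<^sub>C (x * y)"
    and scaleC_mult_right: "x * (a *\<^sub>C y) = a *\<^sub>C (x * y)"
    and norm_scaleC: "norm (a *\<^sub>C x) = cmod a * norm x"
    and adj_adj: "adj (adj x) = x"
    and adj_add: "adj (x + y) = adj x + adj y"
    and adj_scaleC: "adj (a *\<^sub>C x) = cnj a *\<^sub>C adj x"
    and adj_mult: "adj (x * y) = adj y * adj x"
    and norm_adj_mult: "norm (adj x * x) = (norm x)\<^sup>2"


section \<open>C*-algebras on a carrier set\<close>

text \<open>The universal property of the rotation algebra ranges over all C*-algebras, hence over
  more than one algebra on the same type; these are given as records.\<close>

record 'b star_struct = "'b ring" +
  scl :: "complex \<Rightarrow> 'b \<Rightarrow> 'b"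
  star :: "'b \<Rightarrow> 'b"

record 'b cstar_struct = "'b star_struct" +
  nrm :: "'b \<Rightarrow> real"

locale cstar_structure = ring B for B :: "'b cstar_struct" (structure) +
  assumes scl_closed: "x \<in> carrier B \<Longrightarrow> scl B a x \<in> carrier B"
    and scl_add_right: "x \<in> carrier B \<Longrightarrow> y \<in> carrier B \<Longrightarrow>
      scl B a (x \<oplus> y) = scl B a x \<oplus> scl B a y"
    and scl_add_left: "x \<in> carrier B \<Longrightarrow> scl B (a + b) x = scl B a x \<oplus> scl B b x"
    and scl_scl: "x \<in> carrier B \<Longrightarrow> scl B a (scl B b x) = scl B (a * b) x"
    and scl_one: "x \<in> carrier B \<Longrightarrow> scl B 1 x = x"
    and scl_mult_left: "x \<in> carrier B \<Longrightarrow> y \<in> carrier B \<Longrightarrow>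
      scl B a x \<otimes> y = scl B a (x \<otimes> y)"
    and scl_mult_right: "x \<in> carrier B \<Longrightarrow> y \<in> carrier B \<Longrightarrow>
      x \<otimes> scl B a y = scl B a (x \<otimes> y)"
    and star_closed: "x \<in> carrier B \<Longrightarrow> star B x \<in> carrier B"
    and star_star: "x \<in> carrier B \<Longrightarrow> star B (star B x) = x"
    and star_add: "x \<in> carrier B \<Longrightarrow> y \<in> carrier B \<Longrightarrow>
      star B (x \<oplus> y) = star B x \<oplus> star B y"
    and star_scl: "x \<in> carrier B \<Longrightarrow> star B (scl B a x) = scl B (cnj a) (star B x)"
    and star_mult: "x \<in> carrier B \<Longrightarrow> y \<in> carrier B \<Longrightarrow>
      star B (x \<otimes> y) = star B y \<otimes> star B x"
    and nrm_nonneg: "x \<in> carrier B \<Longrightarrow> 0 \<le> nrm B x"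
    and nrm_eq_zero: "x \<in> carrier B \<Longrightarrow> nrm B x = 0 \<longleftrightarrow> x = \<zero>"
    and nrm_add: "x \<in> carrier B \<Longrightarrow> y \<in> carrier B \<Longrightarrow> nrm B (x \<oplus> y) \<le> nrm B x + nrm B y"
    and nrm_scl: "x \<in> carrier B \<Longrightarrow> nrm B (scl B a x) = cmod a * nrm B x"
    and nrm_mult: "x \<in> carrier B \<Longrightarrow> y \<in> carrier B \<Longrightarrow> nrm B (x \<otimes> y) \<le> nrm B x * nrm B y"
    and nrm_star_mult: "x \<in> carrier B \<Longrightarrow> nrm B (star B x \<otimes> x) = (nrm B x)\<^sup>2"
    and nrm_complete: "Metric_space.mcomplete (carrier B) (\<lambda>x y. nrm B (x \<ominus> y))"

definition whole :: "'a::cstar_algebra cstar_struct" where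
  "whole = \<lparr>carrier = UNIV, mult = (*), one = 1, zero = 0, add = (+),
     scl = scaleC, star = adj, nrm = norm\<rparr>"

lemma whole_simps [simp]:
  "carrier (whole :: 'a::cstar_algebra cstar_struct) = UNIV"
  "mult (whole :: 'a cstar_struct) = (*)"
  "one (whole :: 'a cstar_struct) = 1"
  "zero (whole :: 'a cstar_struct) = 0"
  "add (whole :: 'a cstar_struct) = (+)"
  "scl (whole :: 'a cstar_struct) = scaleC"
  "star (whole :: 'a cstar_struct) = adj"
  "nrm (whole :: 'a cstar_struct) = norm"
  by (simp_all add: whole_def)

lemma cstar_structure_whole: "cstar_structure (whole :: 'a::cstar_algebra cstar_struct)"
proof -
  have *: "ring (whole :: 'a cstar_struct)"
  proof (rule ringI)
    show "abelian_group (whole :: 'a cstar_struct)"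
      by (rule abelian_groupI) (auto simp: add.assoc add.commute intro: exI[of _ "- _"])
    show "Group.monoid (whole :: 'a cstar_struct)"
      by unfold_locales (auto simp: mult.assoc)
  qed (auto simp: algebra_simps)
  then interpret ring "whole :: 'a cstar_struct" .
  have minus: "x \<ominus>\<^bsub>whole\<^esub> y = x - y" for x y :: 'a
  proof -
    have "(x \<ominus>\<^bsub>whole\<^esub> y) \<oplus>\<^bsub>whole\<^esub> y = x"
      by (simp add: minus_eq a_assoc l_neg del: whole_simps(2-))
    then show ?thesis by (simp add: algebra_simps)
  qed
  have one: "1 *\<^sub>C x = x" for x :: 'a
    using scaleR_scaleC[of 1 x] by simp
  have "Metric_space.mcomplete (UNIV :: 'a set) (\<lambda>x y. norm (x - y))"
    using mcomplete_iff_complete[where 'a = 'a] complete_UNIV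
    by (simp add: dist_norm[abs_def])
  then show ?thesis
    using * by (intro cstar_structure.intro cstar_structure_axioms.intro)
      (simp_all add: minus one scaleC_add_right scaleC_add_left scaleC_scaleC scaleC_mult_left
        scaleC_mult_right adj_adj adj_add adj_scaleC adj_mult norm_triangle_ineq norm_scaleC
        norm_mult_ineq norm_adj_mult)
qed

text \<open>Unital *-homomorphisms; on C*-algebras they are automatically contractive.\<close>

definition star_hom ::
  "('b, 'm) star_struct_scheme \<Rightarrow> ('c, 'n) star_struct_scheme \<Rightarrow> ('b \<Rightarrow> 'c) set" where
  "star_hom B C = {\<phi> \<in> ring_hom B C.
     (\<forall>a. \<forall>x \<in> carrier B. \<phi> (scl B a x) = scl C a (\<phi> x)) \<and>
     (\<forall>x \<in> carrier B. \<phi> (star B x) = star C (\<phi> x))}"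

definition cstar_automorphism :: "('a::cstar_algebra \<Rightarrow> 'a) \<Rightarrow> bool" where
  "cstar_automorphism \<alpha> \<longleftrightarrow> \<alpha> \<in> star_hom whole whole \<and> bij \<alpha>"


section \<open>Rotation algebras\<close>

definition unitary_in :: "('b, 'm) star_struct_scheme \<Rightarrow> 'b \<Rightarrow> bool" where
  "unitary_in B x \<longleftrightarrow> x \<in> carrier B \<and>
     star B x \<otimes>\<^bsub>B\<^esub> x = \<one>\<^bsub>B\<^esub> \<and> x \<otimes>\<^bsub>B\<^esub> star B x = \<one>\<^bsub>B\<^esub>"

definition rotation_pair ::
  "real \<Rightarrow> ('b, 'm) star_struct_scheme \<Rightarrow> 'b \<Rightarrow> 'b \<Rightarrow> bool" where
  "rotation_pair \<theta> B x y \<longleftrightarrow> unitary_in B x \<and> unitary_in B y \<and>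
     y \<otimes>\<^bsub>B\<^esub> x = scl B (exp (2 * pi * \<i> * \<theta>)) (x \<otimes>\<^bsub>B\<^esub> y)"

definition cstar_subalgebra :: "'a::cstar_algebra set \<Rightarrow> bool" where
  "cstar_subalgebra S \<longleftrightarrow> closed S \<and> 1 \<in> S \<and> (\<forall>x \<in> S. \<forall>y \<in> S. x + y \<in> S \<and> x * y \<in> S) \<and>
     (\<forall>a. \<forall>x \<in> S. a *\<^sub>C x \<in> S) \<and> (\<forall>x \<in> S. adj x \<in> S)"

text \<open>The type of \<open>u\<close> and \<open>v\<close> is the universal C*-algebra generated by unitaries \<open>u\<close> and \<open>v\<close>
  with \<open>v u = exp (2 \<pi> i \<theta>) u v\<close>. Restricting the carrier of \<open>B\<close> to subsets of the type \<open>'a\<close>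
  loses nothing: only the C*-subalgebra of \<open>B\<close> generated by \<open>x\<close> and \<open>y\<close> matters, it is separable,
  hence of at most the cardinality of the continuum, and the nonzero complex vector space \<open>'a\<close> has
  at least that cardinality.\<close>

definition rotation_algebra :: "real \<Rightarrow> 'a::cstar_algebra \<Rightarrow> 'a \<Rightarrow> bool" where
  "rotation_algebra \<theta> u v \<longleftrightarrow>
     rotation_pair \<theta> whole u v \<and>
     cstar_subalgebra hull {u, v} = UNIV \<and>
     (\<forall>(B :: 'a cstar_struct) x y. cstar_structure B \<and> rotation_pair \<theta> B x y \<longrightarrow>
        (\<exists>!\<phi>. \<phi> \<in> star_hom whole B \<and> \<phi> u = x \<and> \<phi> v = y))"


section \<open>Continuous functional calculus on the circle\<close>

abbreviation circle :: "complex set" where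
  "circle \<equiv> sphere 0 1"

text \<open>The *-algebra of continuous functions on the circle, represented by functions that are
  \<^const>\<open>undefined\<close> off the circle.\<close>

definition C_circle :: "(complex \<Rightarrow> complex) star_struct" where
  "C_circle = \<lparr>carrier = {g \<in> extensional circle. continuous_on circle g},
     mult = (\<lambda>g h. \<lambda>z\<in>circle. g z * h z), one = (\<lambda>z\<in>circle. 1),
     zero = (\<lambda>z\<in>circle. 0), add = (\<lambda>g h. \<lambda>z\<in>circle. g z + h z),
     scl = (\<lambda>a g. \<lambda>z\<in>circle. a * g z), star = (\<lambda>g. \<lambda>z\<in>circle. cnj (g z))\<rparr>"

text \<open>For unitary \<open>u\<close> and \<open>g\<close> continuous on the circle this is \<open>g(u)\<close>: the image of \<open>g\<close> under the
  unique unital *-homomorphism from the continuous functions on the circle that maps the identity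
  function to \<open>u\<close>. (The spectrum of a unitary is contained in the circle, and this homomorphism
  factors through the restriction to the spectrum.)\<close>

definition circle_calculus :: "'a::cstar_algebra \<Rightarrow> (complex \<Rightarrow> complex) \<Rightarrow> 'a" where
  "circle_calculus u g = (THE x. \<exists>\<Phi> \<in> star_hom C_circle whole.
     \<Phi> (\<lambda>z\<in>circle. z) = u \<and> \<Phi> (restrict g circle) = x)"


section \<open>The automorphisms\<close>

text \<open>Integer powers of a unitary, whose inverse is its adjoint.\<close>

definition unitary_power :: "'a::cstar_algebra \<Rightarrow> int \<Rightarrow> 'a" where
  "unitary_power u d = (if 0 \<le> d then u ^ nat d else adj u ^ nat (- d))"

text \<open>The parameter \<open>\<theta>\<close> enters through the generators \<open>u\<close> and \<open>v\<close> only.\<close>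

definition rotation_automorphism ::
  "'a::cstar_algebra \<Rightarrow> 'a \<Rightarrow> real \<Rightarrow> int \<Rightarrow> (complex \<Rightarrow> real) \<Rightarrow> 'a \<Rightarrow> 'a" where
  "rotation_automorphism u v \<gamma> d f = (THE \<beta>. cstar_automorphism \<beta> \<and>
     \<beta> u = exp (2 * pi * \<i> * \<gamma>) *\<^sub>C u \<and>
     \<beta> v = exp ((2 * pi * \<i>) *\<^sub>C circle_calculus u (\<lambda>z. complex_of_real (f z)))
             * unitary_power u d * v)"

end

theory Submission
  imports Defs "HOL-Computational_Algebra.Polynomial" "HOL-Real_Asymp.Real_Asymp"
begin

text \<open>
  The unitary \<open>w = \<alpha>(v) v\<^sup>*\<close> commutes with \<open>u\<close>. As \<open>\<theta>\<close> is irrational, the averages of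
  \<open>u\<^sup>-\<^sup>n x u\<^sup>n\<close> kill \<open>u\<^sup>a v\<^sup>b\<close> for \<open>b \<noteq> 0\<close>, so the commutant of \<open>u\<close> is the closure of the Laurent
  polynomials in \<open>u\<close>. Likewise, averaging \<open>v\<^sup>n p(u) v\<^sup>-\<^sup>n\<close> against characters shows that the coefficients
  of a polynomial \<open>p\<close> are bounded by \<open>\<parallel>p(u)\<parallel>\<close>; comparing the coefficients of powers of \<open>p\<close> with
  \<open>\<parallel>p(u)\<parallel>\<close> and with the supremum of \<open>|p|\<close> on the circle, these two norms agree, because the number of
  coefficients grows only linearly. Hence \<open>w = g(u)\<close> for a continuous \<open>g\<close> from the circle to itself,
  and \<open>g(z) = z\<^sup>d exp(2 \<pi> i f(z))\<close> by lifting. Automorphisms agreeing on \<open>u\<close> and \<open>v\<close> are equal by the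
  universal property, applied with \<open>A\<^sub>\<theta>\<close> itself as target.
\<close>

section \<open>Elementary facts on C*-algebras\<close>

lemma scaleC_one [simp]: "1 *\<^sub>C x = (x :: 'a::cstar_algebra)"
  using scaleR_scaleC[of 1 x] by simp

lemma scaleC_zero_left [simp]: "0 *\<^sub>C x = (0 :: 'a::cstar_algebra)"
  using scaleR_scaleC[of 0 x] by simp

lemma scaleC_zero_right [simp]: "c *\<^sub>C (0 :: 'a::cstar_algebra) = 0"
  using norm_scaleC[of c "0::'a"] by simp

lemma scaleC_minus_left: "(- c) *\<^sub>C x = - (c *\<^sub>C (x :: 'a::cstar_algebra))"
  using scaleC_add_left[of "- c" c x] by (simp add: eq_neg_iff_add_eq_0)

lemma scaleC_sum_right: "c *\<^sub>C (\<Sum>i\<in>I. f i) = (\<Sum>i\<in>I. c *\<^sub>C (f i :: 'a::cstar_algebra))"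
  by (induction I rule: infinite_finite_induct) (auto simp: scaleC_add_right)

lemma scaleC_sum_left: "(\<Sum>i\<in>I. f i) *\<^sub>C x = (\<Sum>i\<in>I. f i *\<^sub>C (x :: 'a::cstar_algebra))"
  by (induction I rule: infinite_finite_induct) (auto simp: scaleC_add_left)

lemma scaleC_one_commute: "(c *\<^sub>C 1) * x = x * (c *\<^sub>C (1 :: 'a::cstar_algebra))"
  by (simp add: scaleC_mult_left scaleC_mult_right)

lemma adj_one [simp]: "adj 1 = (1 :: 'a::cstar_algebra)"
  using adj_mult[of "adj (1::'a)" 1] by (simp add: adj_adj)

lemma adj_zero [simp]: "adj 0 = (0 :: 'a::cstar_algebra)"
  using adj_scaleC[of 0 "0::'a"] by simp

lemma adj_minus: "adj (- x) = - adj (x :: 'a::cstar_algebra)"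
  using adj_scaleC[of "-1" x] by (simp add: scaleC_minus_left)

lemma adj_diff: "adj (x - y) = adj x - adj (y :: 'a::cstar_algebra)"
  using adj_add[of x "- y"] by (simp add: adj_minus)

lemma adj_power: "adj (x ^ n) = adj x ^ n" for x :: "'a::cstar_algebra"
  by (induction n) (auto simp: adj_mult power_commutes)

text \<open>The C*-identity and submultiplicativity give
  \<open>norm y ^ 2 \<le> norm (adj y) * norm y\<close>; dividing by \<open>norm y\<close> and then
  exchanging \<open>x\<close> with \<open>adj x\<close> yields both inequalities.\<close>

lemma norm_adj [simp]: "norm (adj x) = norm (x :: 'a::cstar_algebra)"
proof -
  have *: "norm y \<le> norm (adj y)" for y :: 'a
  proof (cases "y = 0")
    case False
    have "norm y * norm y \<le> norm (adj y) * norm y"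
      using norm_mult_ineq[of "adj y" y] by (simp add: norm_adj_mult power2_eq_square)
    then show ?thesis
      using False by simp
  qed simp
  show ?thesis
    using *[of x] *[of "adj x"] by (simp add: adj_adj)
qed

lemma norm_unitary:
  assumes "adj x * x = (1 :: 'a::cstar_algebra)"
  shows "norm x = 1"
  using norm_adj_mult[of x] assms by (simp add: power2_eq_1_iff) (use norm_ge_zero[of x] in linarith)

lemma norm_unitary_mult:
  assumes "adj x * x = (1 :: 'a::cstar_algebra)"
  shows "norm (x * y) = norm y"
proof -
  have "adj (x * y) * (x * y) = adj y * (adj x * x) * y"
    by (simp add: adj_mult mult.assoc)
  then have "(norm (x * y))\<^sup>2 = (norm y)\<^sup>2"
    using norm_adj_mult[of "x * y"] norm_adj_mult[of y] by (simp add: assms)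
  then show ?thesis by simp
qed

lemma norm_mult_unitary:
  assumes "x * adj x = (1 :: 'a::cstar_algebra)"
  shows "norm (y * x) = norm y"
  using norm_unitary_mult[of "adj x" "adj y"] assms norm_adj[of "y * x"]
  by (simp add: adj_adj adj_mult)

text \<open>For normal \<open>x\<close> two uses of the C*-identity give
  \<open>norm (x ^ 2) = (norm x)\<^sup>2\<close>, and \<open>x ^ 2\<close> is again normal, so
  squaring can be iterated. Exponents that are powers of two suffice for comparing growth
  rates.\<close>

lemma norm_power_normal:
  assumes "adj x * x = x * adj (x :: 'a::cstar_algebra)"
  shows "norm (x ^ 2 ^ n) = norm x ^ 2 ^ n"
  using assms
proof (induction n arbitrary: x)
  case (Suc n)
  have eq: "adj (x ^ 2) * x ^ 2 = (adj x * x) ^ 2"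
  proof -
    have "adj (x ^ 2) * x ^ 2 = adj x * (adj x * x) * x"
      by (simp add: power2_eq_square adj_mult mult.assoc)
    also have "\<dots> = adj x * (x * adj x) * x"
      by (simp only: Suc.prems)
    finally show ?thesis by (simp add: power2_eq_square mult.assoc)
  qed
  have "(norm (x ^ 2))\<^sup>2 = norm (adj (adj x * x) * (adj x * x))"
    using norm_adj_mult[of "x ^ 2"] eq by (simp add: adj_mult adj_adj power2_eq_square)
  also have "\<dots> = ((norm x)\<^sup>2)\<^sup>2"
    by (simp only: norm_adj_mult)
  finally have sq: "norm (x ^ 2) = (norm x)\<^sup>2"
    by (rule power2_eq_imp_eq) simp_all
  have "adj (x ^ 2) * x ^ 2 = x ^ 2 * adj (x ^ 2)"
  proof -
    have "x ^ 2 * adj (x ^ 2) = x * (x * adj x) * adj x"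
      by (simp add: power2_eq_square adj_mult mult.assoc)
    also have "\<dots> = x * (adj x * x) * adj x"
      by (simp only: Suc.prems)
    also have "\<dots> = (x * adj x) * (x * adj x)"
      by (simp only: mult.assoc)
    finally have "x ^ 2 * adj (x ^ 2) = (x * adj x) ^ 2"
      by (simp only: power2_eq_square[of "x * adj x"])
    then show ?thesis using eq by (simp only: Suc.prems)
  qed
  from Suc.IH[OF this] show ?case
    by (simp add: sq power_mult)
qed simp

lemma norm_scaleC_one [simp]: "norm (c *\<^sub>C (1 :: 'a::cstar_algebra)) = cmod c"
  by (simp add: norm_scaleC)

lemma scaleC_tendsto_zero:
  assumes "c \<longlonglongrightarrow> 0"
  shows "(\<lambda>n. c n *\<^sub>C (x :: 'a::cstar_algebra)) \<longlonglongrightarrow> 0"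
  using tendsto_mult_left_zero[OF tendsto_norm_zero[OF assms], of "norm x"]
  by (rule_tac tendsto_norm_zero_cancel) (simp add: norm_scaleC)


section \<open>Averages of characters\<close>

text \<open>The geometric sums stay bounded by \<open>2 / cmod (1 - w)\<close>, so division by
  \<open>N\<close> sends them to zero.\<close>

lemma average_powers_tendsto_zero:
  fixes w :: complex
  assumes "cmod w = 1" "w \<noteq> 1"
  shows "(\<lambda>N. (\<Sum>n<N. w ^ n) / of_nat N) \<longlonglongrightarrow> 0"
proof (rule tendsto_norm_zero_cancel, rule tendsto_sandwich[where f = "\<lambda>_. 0"])
  have "cmod (\<Sum>n<N. w ^ n) \<le> 2 / cmod (1 - w)" for N
  proof -
    have "cmod (1 - w ^ N) \<le> 2"
      using norm_triangle_ineq4[of 1 "w ^ N"] assms by (simp add: norm_power)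
    then show ?thesis
      using assms by (simp add: sum_gp_strict norm_divide divide_right_mono)
  qed
  then show "\<forall>\<^sub>F N in sequentially.
      norm ((\<Sum>n<N. w ^ n) / of_nat N) \<le> 2 / cmod (1 - w) / real N"
    by (intro always_eventually allI) (simp only: norm_divide norm_of_nat divide_right_mono of_nat_0_le_iff)
  show "(\<lambda>N. 2 / cmod (1 - w) / real N) \<longlonglongrightarrow> 0"
    by (intro lim_const_over_n)
qed auto

text \<open>Cesaro means. At \<open>N = 0\<close> the value is \<open>0\<close>, so constants are
  reproduced only from \<open>N = 1\<close> on.\<close>

definition average :: "(nat \<Rightarrow> 'a::real_normed_vector) \<Rightarrow> nat \<Rightarrow> 'a" where
  "average x N = (1 / real N) *\<^sub>R (\<Sum>n<N. x n)"

lemma average_add: "average (\<lambda>n. x n + y n) N = average x N + average y N"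
  by (simp add: average_def sum.distrib scaleR_add_right)

lemma average_diff: "average (\<lambda>n. x n - y n) N = average x N - average y N"
  by (simp add: average_def sum_subtractf scaleR_diff_right)

lemma average_scaleR: "average (\<lambda>n. r *\<^sub>R x n) N = r *\<^sub>R average x N"
  by (simp only: average_def scaleR_sum_right[symmetric] scaleR_left_commute)

lemma average_sum: "average (\<lambda>n. \<Sum>i\<in>I. x i n) N = (\<Sum>i\<in>I. average (x i) N)"
  unfolding average_def scaleR_sum_right by (rule sum.swap)

lemma average_const: "N > 0 \<Longrightarrow> average (\<lambda>_. x) N = x"
  by (simp add: average_def sum_constant_scaleR)

lemma norm_average_le:
  assumes "\<And>n. norm (x n) \<le> M" "0 \<le> M"
  shows "norm (average x N) \<le> M"
proof -
  have "norm (\<Sum>n<N. x n) \<le> (\<Sum>n<N. M)"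
    by (intro sum_norm_le) (use assms in auto)
  then have "norm (average x N) \<le> (1 / real N) * (real N * M)"
    unfolding average_def norm_scaleR by (intro mult_mono) auto
  then show ?thesis using assms(2) by (cases "N = 0") auto
qed

lemma average_powers_scaleC:
  fixes x :: "'a::cstar_algebra"
  assumes "cmod w = 1"
  shows "average (\<lambda>n. w ^ n *\<^sub>C x) \<longlonglongrightarrow> (if w = 1 then x else 0)"
proof (cases "w = 1")
  case True
  have "\<forall>\<^sub>F N in sequentially. average (\<lambda>n. w ^ n *\<^sub>C x) N = x"
    using eventually_gt_at_top[of 0] by eventually_elim (simp add: True average_const)
  then show ?thesis using True by (simp add: tendsto_eventually)
next
  case False
  have "average (\<lambda>n. w ^ n *\<^sub>C x) = (\<lambda>N. ((\<Sum>n<N. w ^ n) / of_nat N) *\<^sub>C x)"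
    by (rule ext) (simp add: average_def scaleR_scaleC scaleC_sum_left[symmetric] scaleC_scaleC)
  then show ?thesis
    using scaleC_tendsto_zero[OF average_powers_tendsto_zero[OF assms False], of x] False by simp
qed

text \<open>The summand of index \<open>k\<close> is the limit of the averages of the sums twisted by \<open>w\<^sup>-\<^sup>k\<^sup>n\<close>.\<close>

lemma norm_fourier_coefficient_le:
  fixes x :: "nat \<Rightarrow> 'a::cstar_algebra"
  assumes w: "cmod w = 1" "\<And>n. n > 0 \<Longrightarrow> w ^ n \<noteq> 1"
    and le: "\<And>n. norm (\<Sum>j\<le>D. (w ^ n) ^ j *\<^sub>C x j) \<le> M" and "k \<le> D"
  shows "norm (x k) \<le> M"
proof -
  have M: "0 \<le> M" using le[of 0] norm_ge_zero order_trans by blast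
  have w0: "w \<noteq> 0" using w(1) by auto
  let ?y = "\<lambda>j n. ((w ^ j / w ^ k) ^ n) *\<^sub>C x j"
  \<comment> \<open>Since \<open>w\<close> has infinite order, its powers are distinct, and the
    twist leaves only index \<open>k\<close> without oscillation.\<close>
  have one: "w ^ j / w ^ k = 1 \<longleftrightarrow> j = k" for j
  proof (cases j k rule: linorder_cases)
    case less
    then have "w ^ k = w ^ j * w ^ (k - j)" by (simp flip: power_add)
    then show ?thesis using less w(2)[of "k - j"] w0 by (auto simp: field_simps)
  next
    case greater
    then have "w ^ j = w ^ k * w ^ (j - k)" by (simp flip: power_add)
    then show ?thesis using greater w(2)[of "j - k"] w0 by (auto simp: field_simps)
  qed (use w0 in auto)
  have "average (?y j) \<longlonglongrightarrow> (if j = k then x j else 0)" for j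
    using average_powers_scaleC[of "w ^ j / w ^ k" "x j"] w(1) one
    by (simp add: norm_divide norm_power)
  then have "(\<lambda>N. \<Sum>j\<le>D. average (?y j) N) \<longlonglongrightarrow> (\<Sum>j\<le>D. if j = k then x j else 0)"
    by (intro tendsto_sum) auto
  then have lim: "average (\<lambda>n. \<Sum>j\<le>D. ?y j n) \<longlonglongrightarrow> x k"
    using \<open>k \<le> D\<close> by (simp flip: average_sum)
  have "norm (\<Sum>j\<le>D. ?y j n) \<le> M" for n
  proof -
    have "(\<Sum>j\<le>D. ?y j n) = (1 / (w ^ k) ^ n) *\<^sub>C (\<Sum>j\<le>D. (w ^ n) ^ j *\<^sub>C x j)"
      unfolding scaleC_sum_right scaleC_scaleC
      by (intro sum.cong refl) (simp add: power_divide power_mult[symmetric] mult.commute[of n])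
    then show ?thesis
      using le[of n] w(1) by (simp add: norm_scaleC norm_divide norm_power)
  qed
  from norm_average_le[OF this M] show ?thesis
    by (intro tendsto_upperbound[OF tendsto_norm[OF lim]]) auto
qed


section \<open>Polynomials in an algebra element\<close>

definition poly_eval :: "complex poly \<Rightarrow> 'a::cstar_algebra \<Rightarrow> 'a" where
  "poly_eval p x = (\<Sum>i\<le>degree p. coeff p i *\<^sub>C x ^ i)"

lemma poly_eval_altdef:
  assumes "degree p \<le> N"
  shows "poly_eval p x = (\<Sum>i\<le>N. coeff p i *\<^sub>C x ^ i)"
  unfolding poly_eval_def using assms
  by (intro sum.mono_neutral_left) (auto simp: coeff_eq_0)

lemma poly_eval_0 [simp]: "poly_eval 0 x = 0"
  by (simp add: poly_eval_def)

lemma poly_eval_pCons: "poly_eval (pCons c p) x = c *\<^sub>C 1 + x * poly_eval p x"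
proof -
  have "poly_eval (pCons c p) x = (\<Sum>i\<le>Suc (degree p). coeff (pCons c p) i *\<^sub>C x ^ i)"
    by (rule poly_eval_altdef) (simp add: degree_pCons_le)
  then show ?thesis
    by (subst (asm) sum.atMost_Suc_shift)
      (simp add: poly_eval_def sum_distrib_left scaleC_mult_right)
qed

lemma poly_eval_add: "poly_eval (p + q) x = poly_eval p x + poly_eval q x"
proof -
  let ?N = "max (degree p) (degree q)"
  have "degree (p + q) \<le> ?N" by (rule degree_add_le_max)
  then show ?thesis
    by (simp add: poly_eval_altdef[of _ ?N] scaleC_add_left sum.distrib)
qed

lemma poly_eval_smult: "poly_eval (smult c p) x = c *\<^sub>C poly_eval p x"
  by (simp add: poly_eval_altdef[of _ "degree p"] scaleC_sum_right scaleC_scaleC degree_smult_le)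

lemma poly_eval_mult: "poly_eval (p * q) x = poly_eval p x * poly_eval q x"
  by (induction p)
    (simp_all add: mult_pCons_left poly_eval_add poly_eval_smult poly_eval_pCons ring_distribs
      scaleC_mult_left mult.assoc)

lemma poly_eval_1 [simp]: "poly_eval 1 x = 1"
  by (simp add: poly_eval_def)

lemma poly_eval_power: "poly_eval (p ^ n) x = poly_eval p x ^ n"
  by (induction n) (auto simp: poly_eval_mult)

lemma poly_eval_monom: "poly_eval (monom 1 n) x = x ^ n"
  by (induction n) (auto simp: monom_0 monom_Suc poly_eval_pCons)

lemma poly_eval_commute:
  assumes "x * y = y * x"
  shows "poly_eval p x * y = y * poly_eval p x"
proof (induction p)
  case (pCons c p)
  then show ?case
    using assms by (simp add: poly_eval_pCons ring_distribs scaleC_mult_left scaleC_mult_right mult.assoc)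
      (simp only: mult.assoc[symmetric])
qed simp

text \<open>If \<open>a > M > 0\<close>, the ratio \<open>r = a / M > 1\<close> would satisfy
  \<open>r ^ N \<le> D * N + 1\<close> along \<open>N = 2 ^ n\<close>, against exponential growth.
  This turns crude coefficient bounds for all powers of a polynomial into sharp norm
  inequalities.\<close>

lemma exponential_beats_linear_bound:
  fixes a M :: real
  assumes "0 \<le> a" "0 \<le> M" and le: "\<And>n. a ^ 2 ^ n \<le> (real D * 2 ^ n + 1) * M ^ 2 ^ n"
  shows "a \<le> M"
proof (rule ccontr)
  assume "\<not> a \<le> M"
  then have "M < a" by simp
  show False
  proof (cases "M = 0")
    case True
    then show False using le[of 0] \<open>M < a\<close> by simp
  next
    case False
    define r where "r = a / M"
    have r: "r > 1" using \<open>M < a\<close> False assms by (simp add: r_def)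
    have "r ^ 2 ^ n \<le> real D * 2 ^ n + 1" for n
      using le[of n] False assms by (simp add: r_def power_divide field_simps)
    then have bound: "1 \<le> (real D * real (2 ^ n) + 1) / r ^ 2 ^ n" for n
      using r by (simp add: field_simps)
    have "(\<lambda>N. (real D * real N + 1) / r ^ N) \<longlonglongrightarrow> 0"
      using r by real_asymp
    moreover have "filterlim (\<lambda>n. 2 ^ n :: nat) at_top sequentially"
      by real_asymp
    ultimately have "(\<lambda>n. (real D * real (2 ^ n) + 1) / r ^ 2 ^ n) \<longlonglongrightarrow> 0"
      by (rule filterlim_compose)
    then have "(1::real) \<le> 0"
      by (rule tendsto_lowerbound) (use bound in auto)
    then show False by simp
  qed
qed


section \<open>Laurent polynomials in a unitary\<close>

text \<open>Pairs an algebra element with the function given by the same expression in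
  \<open>z\<close>, where \<open>cnj\<close> stands for the inverse, so only values on the circle
  are meaningful. It is a relation because the function is known to depend on the element alone only
  after \<open>laurent_le_norm\<close>.\<close>

inductive laurent :: "'a::cstar_algebra \<Rightarrow> 'a \<Rightarrow> (complex \<Rightarrow> complex) \<Rightarrow> bool" for u where
  const: "laurent u (c *\<^sub>C 1) (\<lambda>_. c)"
| gen: "laurent u u (\<lambda>z. z)"
| gen_adj: "laurent u (adj u) cnj"
| add: "laurent u x g \<Longrightarrow> laurent u y h \<Longrightarrow> laurent u (x + y) (\<lambda>z. g z + h z)"
| mult: "laurent u x g \<Longrightarrow> laurent u y h \<Longrightarrow> laurent u (x * y) (\<lambda>z. g z * h z)"

lemma laurent_one: "laurent u 1 (\<lambda>_. 1)"
  using laurent.const[of u 1] by simp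

lemma laurent_scaleC: "laurent u x g \<Longrightarrow> laurent u (c *\<^sub>C x) (\<lambda>z. c * g z)"
  using laurent.mult[OF laurent.const[of u c]] by (simp add: scaleC_mult_left)

lemma laurent_minus: "laurent u x g \<Longrightarrow> laurent u (- x) (\<lambda>z. - g z)"
  using laurent_scaleC[of u x g "-1"] by (simp add: scaleC_minus_left)

lemma laurent_diff: "laurent u x g \<Longrightarrow> laurent u y h \<Longrightarrow> laurent u (x - y) (\<lambda>z. g z - h z)"
  using laurent.add[OF _ laurent_minus] by fastforce

lemma laurent_continuous: "laurent u x g \<Longrightarrow> continuous_on S g"
  by (induction rule: laurent.induct) (auto intro!: continuous_intros)

lemma laurent_commute:
  assumes "laurent u x g" "y * u = u * y" "y * adj u = adj u * y"
  shows "x * y = y * x"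
  using assms
proof (induction rule: laurent.induct)
  case (mult x g x' h)
  then have "x * x' * y = x * (y * x')" by (simp add: mult.assoc)
  also have "\<dots> = (y * x) * x'" using mult by (simp flip: mult.assoc)
  finally show ?case by (simp add: mult.assoc)
qed (simp_all add: scaleC_mult_left scaleC_mult_right ring_distribs)

text \<open>Moving \<open>v\<close> past \<open>u\<close> or \<open>adj u\<close> costs only a
  scalar, so conjugation by \<open>v\<close> preserves the Laurent polynomials. The scalars are left
  general so that the lemma also applies to \<open>adj v\<close>.\<close>

lemma laurent_conjugate:
  assumes "laurent u x g" "v * adj v = 1" "adj v * v = 1"
    and "v * u = c *\<^sub>C (u * v)" "v * adj u = d *\<^sub>C (adj u * v)"
  shows "\<exists>y h. laurent u y h \<and> v * x = y * v"
  using assms(1)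
proof (induction rule: laurent.induct)
  case (const c)
  have "v * (c *\<^sub>C 1) = (c *\<^sub>C 1) * v" by (simp add: scaleC_one_commute)
  then show ?case using laurent.const by blast
next
  case gen
  have "v * u = (c *\<^sub>C u) * v" by (simp add: assms scaleC_mult_left)
  then show ?case using laurent_scaleC[OF laurent.gen] by blast
next
  case gen_adj
  have "v * adj u = (d *\<^sub>C adj u) * v" by (simp add: assms scaleC_mult_left)
  then show ?case using laurent_scaleC[OF laurent.gen_adj] by blast
next
  case (add x g y h)
  then obtain x' g' y' h' where "laurent u x' g'" "v * x = x' * v" "laurent u y' h'" "v * y = y' * v"
    by blast
  then have "laurent u (x' + y') (\<lambda>z. g' z + h' z)" "v * (x + y) = (x' + y') * v"
    by (auto simp: ring_distribs intro: laurent.add)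
  then show ?case by blast
next
  case (mult x g y h)
  then obtain x' g' y' h' where *: "laurent u x' g'" "v * x = x' * v" "laurent u y' h'" "v * y = y' * v"
    by blast
  have "v * (x * y) = x' * (v * y)" using *(2) by (simp flip: mult.assoc)
  then have "v * (x * y) = (x' * y') * v" using *(4) by (simp add: mult.assoc)
  then show ?case using laurent.mult[OF *(1,3)] by blast
qed

text \<open>Here \<open>l\<close> plays the role of \<open>exp(2 pi i \<theta>)\<close>, and
  irrationality of \<open>\<theta>\<close> becomes the condition that \<open>l\<close> is not a root
  of unity. That \<open>u\<close> and \<open>v\<close> generate the algebra is assumed only for
  \<open>unitary_commuting_with_u\<close>, and the universal property enters only in the final
  theorem.\<close>

locale rotation_unitaries =
  fixes u v :: "'a::cstar_algebra" and l :: complex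
  assumes u: "adj u * u = 1" "u * adj u = 1"
    and v: "adj v * v = 1" "v * adj v = 1"
    and vu: "v * u = l *\<^sub>C (u * v)"
    and l: "cmod l = 1" "\<And>n. n > 0 \<Longrightarrow> l ^ n \<noteq> 1"
begin

section \<open>Coefficient bounds and the comparison of the norm with the supremum on the
  circle\<close>

lemma v_power_u_power: "v ^ n * u ^ j = (l ^ n) ^ j *\<^sub>C (u ^ j * v ^ n)"
proof -
  have 1: "v ^ n * u = l ^ n *\<^sub>C (u * v ^ n)" for n
  proof (induction n)
    case (Suc n)
    have "v ^ Suc n * u = v * (v ^ n * u)" by (simp add: mult.assoc)
    also have "\<dots> = l ^ n *\<^sub>C ((v * u) * v ^ n)" by (simp add: Suc scaleC_mult_right mult.assoc)
    finally show ?case by (simp add: vu scaleC_mult_left scaleC_scaleC mult.assoc mult.commute)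
  qed simp
  show ?thesis
  proof (induction j)
    case (Suc j)
    have "v ^ n * u ^ Suc j = (v ^ n * u) * u ^ j" by (simp add: mult.assoc)
    also have "\<dots> = l ^ n *\<^sub>C (u * (v ^ n * u ^ j))" by (simp add: 1 scaleC_mult_left mult.assoc)
    finally show ?case by (simp add: Suc scaleC_mult_right scaleC_scaleC mult.assoc)
  qed simp
qed

lemma norm_u_power_mult: "norm (u ^ n * x) = norm x"
  by (rule norm_unitary_mult) (simp add: adj_power left_right_inverse_power u)

text \<open>Conjugation by \<open>v ^ n\<close> is isometric and replaces \<open>u\<close> by
  \<open>l ^ n *\<^sub>C u\<close>. All twisted sums therefore have the norm of \<open>p(u)\<close>,
  and averaging isolates a single coefficient.\<close>

lemma norm_coeff_le_norm_eval: "cmod (coeff p k) \<le> norm (poly_eval p u)"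
proof (cases "k \<le> degree p")
  case True
  have eq: "(\<Sum>j\<le>degree p. (l ^ n) ^ j *\<^sub>C coeff p j *\<^sub>C u ^ j) = v ^ n * poly_eval p u * adj v ^ n" for n
  proof -
    have "(l ^ n) ^ j *\<^sub>C coeff p j *\<^sub>C u ^ j = v ^ n * (coeff p j *\<^sub>C u ^ j) * adj v ^ n" for j
      using left_right_inverse_power[OF v(2)]
      by (simp add: scaleC_mult_right scaleC_mult_left v_power_u_power scaleC_scaleC mult.assoc mult.commute)
    then show ?thesis by (simp add: poly_eval_def sum_distrib_left sum_distrib_right)
  qed
  have iso: "norm (v ^ n * y * adj v ^ n) = norm y" for n y
    by (subst norm_mult_unitary) (auto simp: norm_unitary_mult adj_power adj_adj left_right_inverse_power v)
  have "norm (coeff p k *\<^sub>C u ^ k) \<le> norm (poly_eval p u)"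
    using norm_fourier_coefficient_le[where x = "\<lambda>j. coeff p j *\<^sub>C u ^ j", OF l _ True]
      eq_refl[OF trans[OF arg_cong[OF eq, of norm] iso]] by blast
  then show ?thesis
    using norm_u_power_mult[of k 1] by (simp add: norm_scaleC)
qed (simp add: coeff_eq_0)

text \<open>The averaging argument with \<open>1\<close> in place of \<open>u ^ j\<close>: the
  twisted sum is the scalar \<open>poly p (l ^ n)\<close>, a value of \<open>p\<close> on the
  circle.\<close>

lemma norm_coeff_le_sup:
  assumes "\<And>z. z \<in> circle \<Longrightarrow> cmod (poly p z) \<le> M"
  shows "cmod (coeff p k) \<le> M"
proof (cases "k \<le> degree p")
  case True
  have "norm (\<Sum>j\<le>degree p. (l ^ n) ^ j *\<^sub>C coeff p j *\<^sub>C (1 :: 'a)) \<le> M" for n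
  proof -
    have "(\<Sum>j\<le>degree p. (l ^ n) ^ j *\<^sub>C coeff p j *\<^sub>C (1 :: 'a)) = poly p (l ^ n) *\<^sub>C 1"
      by (simp add: poly_altdef scaleC_sum_left scaleC_scaleC mult.commute)
    then show ?thesis using assms[of "l ^ n"] l(1) by (simp add: norm_power)
  qed
  then have "norm (coeff p k *\<^sub>C (1 :: 'a)) \<le> M"
    using norm_fourier_coefficient_le[where x = "\<lambda>j. coeff p j *\<^sub>C (1 :: 'a)", OF l _ True] by blast
  then show ?thesis by simp
next
  case False
  have "0 \<le> M" by (rule order_trans[OF norm_ge_zero assms[of 1]]) simp
  with False show ?thesis by (simp add: coeff_eq_0)
qed

text \<open>The degree of \<open>p ^ N\<close> is at most \<open>N\<close> times that of
  \<open>p\<close>, so the number of coefficients grows only linearly in \<open>N\<close>.\<close>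

lemma sum_norm_coeff_le:
  assumes "\<And>k. cmod (coeff (p ^ N) k) \<le> B"
  shows "(\<Sum>i\<le>degree (p ^ N). cmod (coeff (p ^ N) i)) \<le> (real (degree p) * real N + 1) * B"
proof -
  have "0 \<le> B" using assms norm_ge_zero order_trans by blast
  have "(\<Sum>i\<le>degree (p ^ N). cmod (coeff (p ^ N) i)) \<le> (\<Sum>i\<le>degree (p ^ N). B)"
    by (intro sum_mono assms)
  also have "\<dots> = (real (degree (p ^ N)) + 1) * B" by (simp add: algebra_simps)
  also have "real (degree (p ^ N)) \<le> real (degree p) * real N"
    using degree_power_le[of p N] by (metis of_nat_le_iff of_nat_mult)
  finally show ?thesis
    using \<open>0 \<le> B\<close> by (simp add: mult_right_mono)
qed

text \<open>By normality the norm of \<open>p(u)\<close> to the power \<open>2 ^ n\<close> is the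
  norm of \<open>p ^ 2 ^ n\<close> at \<open>u\<close>, which is at most the sum of its
  coefficients' moduli. Each of these is at most \<open>M ^ 2 ^ n\<close>, and the linear factor
  disappears in the limit.\<close>

lemma norm_poly_eval_le:
  assumes "\<And>z. z \<in> circle \<Longrightarrow> cmod (poly p z) \<le> M"
  shows "norm (poly_eval p u) \<le> M"
proof -
  let ?x = "poly_eval p u"
  have M: "0 \<le> M" by (rule order_trans[OF norm_ge_zero assms[of 1]]) simp
  \<comment> \<open>Normality in two rounds: \<open>p(u)\<close> commutes with \<open>adj u\<close>;
    taking adjoints, \<open>adj ?x\<close> commutes with \<open>u\<close>, hence with
    \<open>p(u)\<close>.\<close>
  have "?x * adj u = adj u * ?x" by (rule poly_eval_commute) (simp add: u)
  from arg_cong[OF this, of adj] have "u * adj ?x = adj ?x * u"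
    by (simp add: adj_mult adj_adj)
  then have normal: "adj ?x * ?x = ?x * adj ?x" by (simp add: poly_eval_commute)
  show ?thesis
  proof (rule exponential_beats_linear_bound)
    fix n
    let ?N = "2 ^ n :: nat"
    have "norm ?x ^ ?N = norm (poly_eval (p ^ ?N) u)"
      by (simp add: norm_power_normal[OF normal] poly_eval_power)
    also have "\<dots> \<le> (\<Sum>i\<le>degree (p ^ ?N). norm (coeff (p ^ ?N) i *\<^sub>C u ^ i))"
      unfolding poly_eval_def by (rule norm_sum)
    also have "\<dots> = (\<Sum>i\<le>degree (p ^ ?N). cmod (coeff (p ^ ?N) i))"
      using norm_u_power_mult[of _ 1] by (simp add: norm_scaleC)
    also have "\<dots> \<le> (real (degree p) * real ?N + 1) * M ^ ?N"
      by (intro sum_norm_coeff_le norm_coeff_le_sup)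
        (auto simp: norm_power poly_power intro!: power_mono assms)
    finally show "norm ?x ^ 2 ^ n \<le> (real (degree p) * 2 ^ n + 1) * M ^ 2 ^ n" by simp
  qed (use M in auto)
qed

text \<open>The same growth argument with the roles exchanged. The modulus of
  \<open>poly p z\<close> is multiplicative, and submultiplicativity is enough on the algebra
  side.\<close>

lemma norm_poly_le_norm_eval:
  assumes "z \<in> circle"
  shows "cmod (poly p z) \<le> norm (poly_eval p u)"
proof (rule exponential_beats_linear_bound)
  fix n
  let ?N = "2 ^ n :: nat"
  have "cmod (poly p z) ^ ?N = cmod (poly (p ^ ?N) z)"
    by (simp add: norm_power poly_power)
  also have "\<dots> \<le> (\<Sum>i\<le>degree (p ^ ?N). cmod (coeff (p ^ ?N) i * z ^ i))"
    unfolding poly_altdef by (rule norm_sum)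
  also have "\<dots> = (\<Sum>i\<le>degree (p ^ ?N). cmod (coeff (p ^ ?N) i))"
    using assms by (simp add: norm_mult norm_power)
  also have "\<dots> \<le> (real (degree p) * real ?N + 1) * norm (poly_eval p u) ^ ?N"
  proof (rule sum_norm_coeff_le)
    show "cmod (coeff (p ^ ?N) k) \<le> norm (poly_eval p u) ^ ?N" for k
      using norm_coeff_le_norm_eval[of "p ^ ?N" k] norm_power_ineq[of "poly_eval p u" ?N]
      by (simp add: poly_eval_power)
  qed
  finally show "cmod (poly p z) ^ 2 ^ n \<le>
      (real (degree p) * 2 ^ n + 1) * norm (poly_eval p u) ^ 2 ^ n" by simp
qed auto

text \<open>A large power of \<open>u\<close> clears the negative powers. On the circle
  \<open>cnj z\<close> is the inverse of \<open>z\<close>, so the same power of \<open>z\<close>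
  clears the function.\<close>

lemma laurent_poly:
  assumes "laurent u x g"
  shows "\<exists>m p. u ^ m * x = poly_eval p u \<and> (\<forall>z\<in>circle. z ^ m * g z = poly p z)"
  using assms
proof (induction rule: laurent.induct)
  case (const c)
  have "u ^ 0 * (c *\<^sub>C 1) = poly_eval [:c:] u \<and> (\<forall>z\<in>circle. z ^ 0 * c = poly [:c:] z)"
    by (simp add: poly_eval_pCons)
  then show ?case by blast
next
  case gen
  have "u ^ 0 * u = poly_eval [:0, 1:] u \<and> (\<forall>z\<in>circle. z ^ 0 * z = poly [:0, 1:] z)"
    by (simp add: poly_eval_pCons)
  then show ?case by blast
next
  case gen_adj
  have "z * cnj z = 1" if "z \<in> circle" for z
    using that complex_norm_square[of z] by simp
  then have "u ^ 1 * adj u = poly_eval 1 u \<and> (\<forall>z\<in>circle. z ^ 1 * cnj z = poly 1 z)"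
    by (simp add: u)
  then show ?case by blast
next
  case (add x g y h)
  then obtain m p k q where
    x: "u ^ m * x = poly_eval p u" "\<And>z. z \<in> circle \<Longrightarrow> z ^ m * g z = poly p z" and
    y: "u ^ k * y = poly_eval q u" "\<And>z. z \<in> circle \<Longrightarrow> z ^ k * h z = poly q z"
    by metis
  let ?r = "monom 1 k * p + monom 1 m * q"
  have "u ^ (m + k) * (x + y) = u ^ k * (u ^ m * x) + u ^ m * (u ^ k * y)"
    by (simp add: distrib_left mult.assoc[symmetric] power_add[symmetric] add.commute[of m k])
  also have "\<dots> = poly_eval ?r u"
    by (simp add: x y poly_eval_add poly_eval_mult poly_eval_monom)
  finally have 1: "u ^ (m + k) * (x + y) = poly_eval ?r u" .
  have "z ^ (m + k) * (g z + h z) = poly ?r z" if "z \<in> circle" for z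
    using x(2)[OF that, symmetric] y(2)[OF that, symmetric]
    by (simp add: poly_monom power_add algebra_simps)
  with 1 show ?case by blast
next
  case (mult x g y h)
  then obtain m p k q where
    x: "u ^ m * x = poly_eval p u" "\<And>z. z \<in> circle \<Longrightarrow> z ^ m * g z = poly p z" and
    y: "u ^ k * y = poly_eval q u" "\<And>z. z \<in> circle \<Longrightarrow> z ^ k * h z = poly q z"
    by metis
  \<comment> \<open>The power meant for \<open>y\<close> has to be moved past
    \<open>x\<close>.\<close>
  have "x * u ^ k = u ^ k * x"
    using power_commutes[of u k] power_commuting_commutes[of u "adj u" k] u
    by (intro laurent_commute[OF mult(1)]) simp_all
  then have "u ^ (m + k) * (x * y) = u ^ m * (x * u ^ k) * y"
    by (simp add: power_add mult.assoc)
  then have 1: "u ^ (m + k) * (x * y) = poly_eval (p * q) u"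
    by (simp add: poly_eval_mult x(1)[symmetric] y(1)[symmetric] mult.assoc)
  have "z ^ (m + k) * (g z * h z) = poly (p * q) z" if "z \<in> circle" for z
    using x(2)[OF that, symmetric] y(2)[OF that, symmetric]
    by (simp add: power_add algebra_simps)
  with 1 show ?case by blast
qed

text \<open>Multiplication by \<open>u ^ m\<close> is isometric and \<open>z ^ m\<close> has modulus
  1 on the circle, so the polynomial estimate carries over.\<close>

lemma laurent_norm_le:
  assumes "laurent u x g" "\<And>z. z \<in> circle \<Longrightarrow> cmod (g z) \<le> M"
  shows "norm x \<le> M"
proof -
  obtain m p where *: "u ^ m * x = poly_eval p u" "\<And>z. z \<in> circle \<Longrightarrow> z ^ m * g z = poly p z"
    using laurent_poly[OF assms(1)] by metis
  have "norm (poly_eval p u) \<le> M"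
    by (intro norm_poly_eval_le) (use assms(2) in \<open>auto simp: *(2)[symmetric] norm_mult norm_power\<close>)
  then show ?thesis using norm_u_power_mult[of m x] *(1) by simp
qed

lemma laurent_le_norm:
  assumes "laurent u x g" "z \<in> circle"
  shows "cmod (g z) \<le> norm x"
proof -
  obtain m p where *: "u ^ m * x = poly_eval p u" "\<And>z. z \<in> circle \<Longrightarrow> z ^ m * g z = poly p z"
    using laurent_poly[OF assms(1)] by metis
  have "cmod (g z) = cmod (poly p z)"
    using assms(2) by (simp add: *(2)[symmetric] norm_mult norm_power)
  also have "\<dots> \<le> norm (poly_eval p u)" by (rule norm_poly_le_norm_eval[OF assms(2)])
  finally show ?thesis using norm_u_power_mult[of m x] *(1) by simp
qed

lemma laurent_adj: "laurent u x g \<Longrightarrow> laurent u (adj x) (\<lambda>z. cnj (g z))"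
proof (induction rule: laurent.induct)
  case (mult x g y h)
  \<comment> \<open>The adjoint reverses products; commutativity of Laurent polynomials in
    \<open>u\<close> restores the order.\<close>
  have "adj y * adj x = adj x * adj y"
  proof -
    have "x * u = u * x" "x * adj u = adj u * x"
      by (intro laurent_commute[OF mult(1)]; simp add: u)+
    from laurent_commute[OF mult(2) this] show ?thesis by (simp flip: adj_mult)
  qed
  then show ?case using laurent.mult[OF mult.IH] by (simp add: adj_mult)
qed (auto simp: adj_scaleC adj_add adj_adj intro: laurent.intros)

end


section \<open>Functional calculus\<close>

lemma real_polynomial_function_laurent:
  assumes "real_polynomial_function p"
  shows "\<exists>y. laurent u y (\<lambda>z. complex_of_real (p z))"
  using assms
proof (induction rule: real_polynomial_function.induct)
  case (linear f)
  interpret bounded_linear f by (rule linear)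
  have f: "f z = Re z * f 1 + Im z * f \<i>" for z
  proof -
    have "f z = f (Re z *\<^sub>R 1 + Im z *\<^sub>R \<i>)" by (rule arg_cong[of _ _ f]) (simp add: complex_eq_iff)
    then show ?thesis by (simp add: add scaleR)
  qed
  \<comment> \<open>Coefficients of \<open>z\<close> and \<open>cnj z\<close> obtained by writing
    \<open>Re z\<close> as \<open>(z + cnj z) / 2\<close> and \<open>Im z\<close> as
    \<open>(z - cnj z) / (2 * \<i>)\<close>.\<close>
  let ?a = "(complex_of_real (f 1) - \<i> * complex_of_real (f \<i>)) / 2"
  let ?b = "(complex_of_real (f 1) + \<i> * complex_of_real (f \<i>)) / 2"
  have "(\<lambda>z. complex_of_real (f z)) = (\<lambda>z. ?a * z + ?b * cnj z)"
  proof (rule ext)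
    show "complex_of_real (f z) = ?a * z + ?b * cnj z" for z
      unfolding f[of z] by (simp add: complex_eq_iff field_simps)
  qed
  moreover have "laurent u (?a *\<^sub>C u + ?b *\<^sub>C adj u) (\<lambda>z. ?a * z + ?b * cnj z)"
    by (intro laurent.add laurent_scaleC laurent.gen laurent.gen_adj)
  ultimately show ?case by (metis (no_types))
next
  case (const c)
  then show ?case using laurent.const by blast
next
  case (add f g)
  then show ?case unfolding of_real_add using laurent.add by blast
next
  case (mult f g)
  then show ?case unfolding of_real_mult using laurent.mult by blast
qed

text \<open>Stone-Weierstrass is applied to the real and imaginary parts separately; real
  polynomials in the coordinates are Laurent polynomials in \<open>z\<close> and
  \<open>cnj z\<close>.\<close>

lemma laurent_dense:
  assumes g: "continuous_on circle g" and "e > 0"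
  shows "\<exists>y h. laurent u y h \<and> (\<forall>z\<in>circle. cmod (g z - h z) < e)"
proof -
  have "e / 2 > 0" using \<open>e > 0\<close> by simp
  have "continuous_on circle (\<lambda>z. Re (g z))" "continuous_on circle (\<lambda>z. Im (g z))"
    using g by (auto intro!: continuous_intros)
  from this[THEN Stone_Weierstrass_real_polynomial_function[OF compact_sphere _ \<open>e / 2 > 0\<close>]]
  obtain p q where p: "real_polynomial_function p" "\<And>z. z \<in> circle \<Longrightarrow> \<bar>Re (g z) - p z\<bar> < e / 2"
    and q: "real_polynomial_function q" "\<And>z. z \<in> circle \<Longrightarrow> \<bar>Im (g z) - q z\<bar> < e / 2"
    by metis
  obtain x y where "laurent u x (\<lambda>z. complex_of_real (p z))" "laurent u y (\<lambda>z. complex_of_real (q z))"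
    using real_polynomial_function_laurent p(1) q(1) by metis
  then have l: "laurent u (x + \<i> *\<^sub>C y) (\<lambda>z. complex_of_real (p z) + \<i> * complex_of_real (q z))"
    by (intro laurent.add laurent_scaleC)
  have "cmod (g z - (complex_of_real (p z) + \<i> * complex_of_real (q z))) < e" if "z \<in> circle" for z
    using cmod_le[of "g z - (complex_of_real (p z) + \<i> * complex_of_real (q z))"]
      p(2)[OF that] q(2)[OF that] by simp
  with l show ?thesis by blast
qed

lemma norm_mult_diff_le:
  fixes a b :: "'b::real_normed_algebra"
  assumes "norm (a - a') \<le> d" "norm (b - b') \<le> d" "d \<le> 1" "norm a \<le> A" "norm b \<le> B"
  shows "norm (a * b - a' * b') \<le> d * (A + B + 1)"
proof -
  have d: "0 \<le> d" using assms(1) norm_ge_zero order_trans by blast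
  have "norm a' \<le> norm a + norm (a - a')"
    using norm_triangle_ineq4[of a "a - a'"] by simp
  then have a': "norm a' \<le> A + 1" using assms by linarith
  have "a * b - a' * b' = (a - a') * b + a' * (b - b')" by (simp add: algebra_simps)
  then have "norm (a * b - a' * b') \<le> norm (a - a') * norm b + norm a' * norm (b - b')"
    by (metis norm_triangle_le add_mono norm_mult_ineq)
  also have "\<dots> \<le> d * B + (A + 1) * d"
    using assms a' d by (intro add_mono mult_mono) (auto intro: order_trans[OF norm_ge_zero])
  finally show ?thesis by (simp add: algebra_simps)
qed

section \<open>Boundedness of *-homomorphisms on the continuous functions on the circle\<close>

lemma C_circle_simps [simp]:
  "carrier C_circle = {g \<in> extensional circle. continuous_on circle g}"
  "mult C_circle g h = (\<lambda>z\<in>circle. g z * h z)"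
  "one C_circle = (\<lambda>z\<in>circle. 1)"
  "add C_circle g h = (\<lambda>z\<in>circle. g z + h z)"
  "scl C_circle a g = (\<lambda>z\<in>circle. a * g z)"
  "star C_circle g = (\<lambda>z\<in>circle. cnj (g z))"
  by (simp_all add: C_circle_def)

lemma restrict_in_C_circle:
  "continuous_on circle g \<Longrightarrow> restrict g circle \<in> carrier C_circle"
  using continuous_on_cong[of circle circle g "restrict g circle"] by simp

text \<open>Elements of \<open>C_circle\<close> are extensional; these forms of the homomorphism
  laws accept any function continuous on the circle and hide the nested restrictions.\<close>

lemma star_hom_C_circle:
  fixes \<Psi> :: "(complex \<Rightarrow> complex) \<Rightarrow> 'a::cstar_algebra"
  assumes \<Psi>: "\<Psi> \<in> star_hom C_circle whole"
    and g: "continuous_on circle g" and h: "continuous_on circle h"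
  shows "\<Psi> (\<lambda>z\<in>circle. g z + h z) = \<Psi> (restrict g circle) + \<Psi> (restrict h circle)"
    and "\<Psi> (\<lambda>z\<in>circle. g z * h z) = \<Psi> (restrict g circle) * \<Psi> (restrict h circle)"
    and "\<Psi> (\<lambda>z\<in>circle. c * g z) = c *\<^sub>C \<Psi> (restrict g circle)"
    and "\<Psi> (\<lambda>z\<in>circle. cnj (g z)) = adj (\<Psi> (restrict g circle))"
    and "\<Psi> (\<lambda>z\<in>circle. 1) = 1"
proof -
  have hom: "\<Psi> \<in> ring_hom C_circle whole" using \<Psi> by (simp add: star_hom_def)
  note gc = restrict_in_C_circle[OF g] and hc = restrict_in_C_circle[OF h]
  have r: "(\<lambda>z\<in>circle. F (restrict g circle z) (restrict h circle z)) = (\<lambda>z\<in>circle. F (g z) (h z))"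
    for F :: "complex \<Rightarrow> complex \<Rightarrow> complex"
    by (rule restrict_ext) simp
  show "\<Psi> (\<lambda>z\<in>circle. g z + h z) = \<Psi> (restrict g circle) + \<Psi> (restrict h circle)"
    using ring_hom_add[OF hom gc hc] r[of "(+)"] by (simp del: restrict_apply)
  show "\<Psi> (\<lambda>z\<in>circle. g z * h z) = \<Psi> (restrict g circle) * \<Psi> (restrict h circle)"
    using ring_hom_mult[OF hom gc hc] r[of "(*)"] by (simp del: restrict_apply)
  have "\<Psi> (scl C_circle c (restrict g circle)) = scl whole c (\<Psi> (restrict g circle))"
    using \<Psi> gc unfolding star_hom_def by blast
  then show "\<Psi> (\<lambda>z\<in>circle. c * g z) = c *\<^sub>C \<Psi> (restrict g circle)"
    using r[of "\<lambda>x _. c * x"] by (simp del: restrict_apply)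
  have "\<Psi> (star C_circle (restrict g circle)) = star whole (\<Psi> (restrict g circle))"
    using \<Psi> gc unfolding star_hom_def by blast
  then show "\<Psi> (\<lambda>z\<in>circle. cnj (g z)) = adj (\<Psi> (restrict g circle))"
    using r[of "\<lambda>x _. cnj x"] by (simp del: restrict_apply)
  show "\<Psi> (\<lambda>z\<in>circle. 1) = 1"
    using ring_hom_one[OF hom] by simp
qed

text \<open>A real function \<open>r\<close> with values in \<open>[-1, 1]\<close> is the real part of the unitary
  \<open>r + i \<surd>(1 - r\<^sup>2)\<close>; this replaces the usual spectral argument for continuity.\<close>

lemma star_hom_C_circle_norm_le_1:
  fixes \<Psi> :: "(complex \<Rightarrow> complex) \<Rightarrow> 'a::cstar_algebra"
  assumes \<Psi>: "\<Psi> \<in> star_hom C_circle whole"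
    and r: "continuous_on circle r" "\<And>z. z \<in> circle \<Longrightarrow> \<bar>r z\<bar> \<le> 1"
  shows "norm (\<Psi> (\<lambda>z\<in>circle. complex_of_real (r z))) \<le> 1"
proof -
  define w where "w = (\<lambda>z. Complex (r z) (sqrt (1 - (r z)\<^sup>2)))"
  have w: "continuous_on circle w"
    unfolding w_def complex_eq using r(1) by (intro continuous_intros) auto
  then have cw: "continuous_on circle (\<lambda>z. cnj (w z))" by (intro continuous_intros)
  let ?w = "\<Psi> (restrict w circle)"
  have "(\<lambda>z\<in>circle. cnj (w z) * w z) = (\<lambda>z\<in>circle. 1)"
  proof (rule restrict_ext)
    fix z :: complex assume "z \<in> circle"
    then have "(r z)\<^sup>2 \<le> 1" using r(2) by (simp add: abs_square_le_1)
    then show "cnj (w z) * w z = 1"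
      by (simp add: w_def complex_eq_iff power2_eq_square[symmetric] algebra_simps)
  qed
  then have "adj ?w * ?w = 1"
    using star_hom_C_circle(2)[OF \<Psi> cw w] star_hom_C_circle(4,5)[OF \<Psi> w w] by simp
  then have nw: "norm ?w = 1" by (rule norm_unitary)
  have "(\<lambda>z\<in>circle. complex_of_real (r z)) = (\<lambda>z\<in>circle. (1 / 2) * (w z + cnj (w z)))"
    by (rule restrict_ext) (simp add: w_def complex_eq_iff)
  then have "\<Psi> (\<lambda>z\<in>circle. complex_of_real (r z)) = (1 / 2) *\<^sub>C (?w + adj ?w)"
    using star_hom_C_circle(3)[OF \<Psi> continuous_on_add[OF w cw] w, of "1 / 2"]
      star_hom_C_circle(1)[OF \<Psi> w cw] star_hom_C_circle(4)[OF \<Psi> w w] by simp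
  then have "norm (\<Psi> (\<lambda>z\<in>circle. complex_of_real (r z))) = (1 / 2) * norm (?w + adj ?w)"
    by (simp add: norm_scaleC)
  also have "\<dots> \<le> 1"
    using norm_triangle_ineq[of ?w "adj ?w"] nw by simp
  finally show ?thesis .
qed

text \<open>The real and imaginary parts of \<open>g / M\<close> each have image of norm at most 1.
  The constant 2 is not sharp, but continuity is all that is wanted.\<close>

lemma star_hom_C_circle_norm_le:
  fixes \<Psi> :: "(complex \<Rightarrow> complex) \<Rightarrow> 'a::cstar_algebra"
  assumes \<Psi>: "\<Psi> \<in> star_hom C_circle whole" and "M > 0"
    and g: "continuous_on circle g" "\<And>z. z \<in> circle \<Longrightarrow> cmod (g z) \<le> M"
  shows "norm (\<Psi> (restrict g circle)) \<le> 2 * M"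
proof -
  let ?R = "\<lambda>z. complex_of_real (Re (g z) / M)" and ?I = "\<lambda>z. complex_of_real (Im (g z) / M)"
  have c: "continuous_on circle ?R" "continuous_on circle ?I"
    using g(1) \<open>M > 0\<close> by (intro continuous_intros; simp)+
  have le: "norm (\<Psi> (restrict ?R circle)) \<le> 1" "norm (\<Psi> (restrict ?I circle)) \<le> 1"
  proof -
    have "\<bar>Re (g z) / M\<bar> \<le> 1" "\<bar>Im (g z) / M\<bar> \<le> 1" if "z \<in> circle" for z
      using g(2)[OF that] abs_Re_le_cmod[of "g z"] abs_Im_le_cmod[of "g z"] \<open>M > 0\<close> by auto
    moreover have "continuous_on circle (\<lambda>z. Re (g z) / M)" "continuous_on circle (\<lambda>z. Im (g z) / M)"
      using g(1) \<open>M > 0\<close> by (intro continuous_intros; simp)+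
    ultimately show "norm (\<Psi> (restrict ?R circle)) \<le> 1" "norm (\<Psi> (restrict ?I circle)) \<le> 1"
      by (intro star_hom_C_circle_norm_le_1[OF \<Psi>]; blast)+
  qed
  have "restrict g circle = (\<lambda>z\<in>circle. complex_of_real M * (?R z + \<i> * ?I z))"
    by (rule restrict_ext) (use \<open>M > 0\<close> in \<open>simp add: complex_eq_iff\<close>)
  moreover have cI: "continuous_on circle (\<lambda>z. \<i> * ?I z)"
    by (intro continuous_on_mult continuous_on_const c(2))
  ultimately have "\<Psi> (restrict g circle) =
      complex_of_real M *\<^sub>C (\<Psi> (restrict ?R circle) + \<i> *\<^sub>C \<Psi> (restrict ?I circle))"
    using star_hom_C_circle(3)[OF \<Psi> continuous_on_add[OF c(1) cI] c(1), of "complex_of_real M"]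
      star_hom_C_circle(1)[OF \<Psi> c(1) cI] star_hom_C_circle(3)[OF \<Psi> c(2) c(2), of "\<i>"]
    by simp
  then have "norm (\<Psi> (restrict g circle)) =
      M * norm (\<Psi> (restrict ?R circle) + \<i> *\<^sub>C \<Psi> (restrict ?I circle))"
    using \<open>M > 0\<close> by (simp add: norm_scaleC)
  also have "\<dots> \<le> M * 2"
    using \<open>M > 0\<close> le norm_triangle_ineq[of "\<Psi> (restrict ?R circle)" "\<i> *\<^sub>C \<Psi> (restrict ?I circle)"]
    by (intro mult_left_mono) (auto simp: norm_scaleC)
  finally show ?thesis by simp
qed

text \<open>A *-homomorphism is determined on Laurent polynomials by its value at the identity
  function.\<close>

lemma laurent_star_hom:
  assumes \<Psi>: "\<Psi> \<in> star_hom C_circle whole" and id: "\<Psi> (\<lambda>z\<in>circle. z) = u" and "laurent u y h"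
  shows "\<Psi> (restrict h circle) = y"
  using assms(3)
proof (induction rule: laurent.induct)
  case (const c)
  show ?case
    using star_hom_C_circle(3)[OF \<Psi>, of "\<lambda>_. 1" "\<lambda>_. 1" c]
      star_hom_C_circle(5)[OF \<Psi>, of "\<lambda>_. 1" "\<lambda>_. 1"]
    by (simp only: mult_1_right continuous_on_const)
next
  case gen
  show ?case by (rule id)
next
  case gen_adj
  show ?case
    using star_hom_C_circle(4)[OF \<Psi>, of "\<lambda>z. z" "\<lambda>z. z"] id
    by (simp only: continuous_on_id)
next
  case (add x g y h)
  then show ?case
    using star_hom_C_circle(1)[OF \<Psi> laurent_continuous[OF add(1)] laurent_continuous[OF add(2)]]
    by (simp only:)
next
  case (mult x g y h)
  then show ?case
    using star_hom_C_circle(2)[OF \<Psi> laurent_continuous[OF mult(1)] laurent_continuous[OF mult(2)]]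
    by (simp only:)
qed

section \<open>The isometric correspondence between continuous functions on the circle and elements
  \<open>g(u)\<close>\<close>

context rotation_unitaries
begin

text \<open>Expresses \<open>x = g(u)\<close>: the pair lies in the closure of the graph of
  \<open>laurent\<close>, for the norm in the algebra and the supremum over the circle. The two
  Laurent estimates make this closure the graph of an isometry.\<close>

definition calculus :: "'a \<Rightarrow> (complex \<Rightarrow> complex) \<Rightarrow> bool" where
  "calculus x g \<longleftrightarrow> (\<forall>e>0. \<exists>y h. laurent u y h \<and> norm (x - y) < e \<and> (\<forall>z\<in>circle. cmod (g z - h z) < e))"

lemma calculusE:
  assumes "calculus x g" "e > 0"
  obtains y h where "laurent u y h" "norm (x - y) < e" "\<And>z. z \<in> circle \<Longrightarrow> cmod (g z - h z) < e"
  using assms unfolding calculus_def by blast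

lemma calculus_laurent: "laurent u x g \<Longrightarrow> calculus x g"
  unfolding calculus_def by (metis diff_self norm_zero)

lemma calculus_cong:
  assumes "calculus x g" "\<And>z. z \<in> circle \<Longrightarrow> g z = h z"
  shows "calculus x h"
  using assms unfolding calculus_def by metis

lemma calculus_limit:
  assumes "\<And>e. e > 0 \<Longrightarrow> \<exists>y h. calculus y h \<and> norm (x - y) < e \<and> (\<forall>z\<in>circle. cmod (g z - h z) < e)"
  shows "calculus x g"
  unfolding calculus_def
proof (intro allI impI)
  fix e :: real assume "e > 0"
  then have e: "e / 2 > 0" by simp
  obtain y h where y: "calculus y h" "norm (x - y) < e / 2" "\<And>z. z \<in> circle \<Longrightarrow> cmod (g z - h z) < e / 2"
    using assms[OF e] by blast
  obtain y' h' where y': "laurent u y' h'" "norm (y - y') < e / 2"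
      "\<And>z. z \<in> circle \<Longrightarrow> cmod (h z - h' z) < e / 2"
    using calculusE[OF y(1) e] by blast
  have "norm (x - y') < e"
    using norm_triangle_lt[of "x - y" "y - y'" e] y(2) y'(2) by simp
  moreover have "cmod (g z - h' z) < e" if "z \<in> circle" for z
    using norm_triangle_lt[of "g z - h z" "h z - h' z" e] y(3)[OF that] y'(3)[OF that] by simp
  ultimately show "\<exists>y h. laurent u y h \<and> norm (x - y) < e \<and> (\<forall>z\<in>circle. cmod (g z - h z) < e)"
    using y'(1) by blast
qed

lemma calculus_le_norm:
  assumes "calculus x g" "z \<in> circle"
  shows "cmod (g z) \<le> norm x"
proof (rule field_le_epsilon)
  fix e :: real assume "e > 0"
  then obtain y h where y: "laurent u y h" "norm (x - y) < e / 2" "cmod (g z - h z) < e / 2"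
    using calculusE[OF assms(1), of "e / 2"] assms(2) by (metis half_gt_zero)
  have "cmod (g z) \<le> cmod (h z) + cmod (g z - h z)" "norm y \<le> norm x + norm (x - y)"
    using norm_triangle_ineq[of "h z" "g z - h z"] norm_triangle_ineq4[of x "x - y"] by simp_all
  then show "cmod (g z) \<le> norm x + e"
    using y laurent_le_norm[OF y(1) assms(2)] by linarith
qed

lemma calculus_norm_le:
  assumes "calculus x g" "\<And>z. z \<in> circle \<Longrightarrow> cmod (g z) \<le> M"
  shows "norm x \<le> M"
proof (rule field_le_epsilon)
  fix e :: real assume "e > 0"
  then obtain y h where y: "laurent u y h" "norm (x - y) < e / 2"
      "\<And>z. z \<in> circle \<Longrightarrow> cmod (g z - h z) < e / 2"
    using calculusE[OF assms(1), of "e / 2"] by (metis half_gt_zero)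
  have "cmod (h z) \<le> M + e / 2" if "z \<in> circle" for z
    using norm_triangle_ineq4[of "g z" "g z - h z"] y(3)[OF that] assms(2)[OF that] by simp
  from laurent_norm_le[OF y(1) this] have "norm y \<le> M + e / 2" .
  moreover have "norm x \<le> norm y + norm (x - y)"
    using norm_triangle_ineq[of y "x - y"] by simp
  ultimately show "norm x \<le> M + e" using y(2) by linarith
qed

lemma calculus_add:
  assumes "calculus x g" "calculus y h"
  shows "calculus (x + y) (\<lambda>z. g z + h z)"
  unfolding calculus_def
proof (intro allI impI)
  fix e :: real assume "e > 0"
  then have e: "e / 2 > 0" by simp
  obtain x' g' where x: "laurent u x' g'" "norm (x - x') < e / 2"
      "\<And>z. z \<in> circle \<Longrightarrow> cmod (g z - g' z) < e / 2"
    using calculusE[OF assms(1) e] by blast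
  obtain y' h' where y: "laurent u y' h'" "norm (y - y') < e / 2"
      "\<And>z. z \<in> circle \<Longrightarrow> cmod (h z - h' z) < e / 2"
    using calculusE[OF assms(2) e] by blast
  have "norm (x + y - (x' + y')) < e"
    using norm_triangle_lt[of "x - x'" "y - y'" e] x(2) y(2) by (simp add: algebra_simps)
  moreover have "cmod (g z + h z - (g' z + h' z)) < e" if "z \<in> circle" for z
    using norm_triangle_lt[of "g z - g' z" "h z - h' z" e] x(3)[OF that] y(3)[OF that]
    by (simp add: algebra_simps)
  ultimately show "\<exists>y' h'. laurent u y' h' \<and> norm (x + y - y') < e \<and>
      (\<forall>z\<in>circle. cmod (g z + h z - h' z) < e)"
    using laurent.add[OF x(1) y(1)] by blast
qed

lemma calculus_mult:
  assumes "calculus x g" "calculus y h"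
  shows "calculus (x * y) (\<lambda>z. g z * h z)"
  unfolding calculus_def
proof (intro allI impI)
  fix e :: real assume "e > 0"
  define K where "K = norm x + norm y + 1"
  \<comment> \<open>The bound 1 is what \<open>norm_mult_diff_le\<close> asks for; the factor 2
    makes \<open>d * K < e\<close> strict.\<close>
  define d where "d = min 1 (e / (2 * K))"
  have K: "K > 0" unfolding K_def using norm_ge_zero[of x] norm_ge_zero[of y] by linarith
  have d: "d > 0" "d \<le> 1" "d * K < e"
  proof -
    show "d > 0" "d \<le> 1" using K \<open>e > 0\<close> by (simp_all add: d_def)
    have "d * K \<le> e / (2 * K) * K" using K by (intro mult_right_mono) (simp_all add: d_def)
    then show "d * K < e" using K \<open>e > 0\<close> by simp
  qed
  obtain x' g' where x: "laurent u x' g'" "norm (x - x') < d"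
      "\<And>z. z \<in> circle \<Longrightarrow> cmod (g z - g' z) < d"
    using calculusE[OF assms(1) d(1)] by blast
  obtain y' h' where y: "laurent u y' h'" "norm (y - y') < d"
      "\<And>z. z \<in> circle \<Longrightarrow> cmod (h z - h' z) < d"
    using calculusE[OF assms(2) d(1)] by blast
  have "norm (x * y - x' * y') < e"
    using norm_mult_diff_le[OF less_imp_le[OF x(2)] less_imp_le[OF y(2)] d(2) order_refl order_refl] d(3)
    by (simp add: K_def)
  moreover have "cmod (g z * h z - g' z * h' z) < e" if "z \<in> circle" for z
    using norm_mult_diff_le[OF less_imp_le[OF x(3)[OF that]] less_imp_le[OF y(3)[OF that]] d(2)
        calculus_le_norm[OF assms(1) that] calculus_le_norm[OF assms(2) that]] d(3)
    by (simp add: K_def)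
  ultimately show "\<exists>y' h'. laurent u y' h' \<and> norm (x * y - y') < e \<and>
      (\<forall>z\<in>circle. cmod (g z * h z - h' z) < e)"
    using laurent.mult[OF x(1) y(1)] by blast
qed

lemma calculus_const: "calculus (c *\<^sub>C 1) (\<lambda>_. c)"
  by (intro calculus_laurent laurent.const)

lemma calculus_one: "calculus 1 (\<lambda>_. 1)"
  by (intro calculus_laurent laurent_one)

lemma calculus_scaleC: "calculus x g \<Longrightarrow> calculus (c *\<^sub>C x) (\<lambda>z. c * g z)"
  using calculus_mult[OF calculus_const[of c]] by (simp add: scaleC_mult_left)

lemma calculus_diff:
  assumes "calculus x g" "calculus y h"
  shows "calculus (x - y) (\<lambda>z. g z - h z)"
  using calculus_add[OF assms(1) calculus_scaleC[OF assms(2), of "-1"]]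
  by (simp add: scaleC_minus_left)

lemma calculus_adj:
  assumes "calculus x g"
  shows "calculus (adj x) (\<lambda>z. cnj (g z))"
  unfolding calculus_def
proof (intro allI impI)
  fix e :: real assume "e > 0"
  then obtain y h where y: "laurent u y h" "norm (x - y) < e"
      "\<And>z. z \<in> circle \<Longrightarrow> cmod (g z - h z) < e"
    using calculusE[OF assms] by blast
  have "norm (adj x - adj y) < e" using y(2) by (simp flip: adj_diff)
  moreover have "cmod (cnj (g z) - cnj (h z)) < e" if "z \<in> circle" for z
    using y(3)[OF that] by (simp flip: complex_cnj_diff)
  ultimately show "\<exists>y h. laurent u y h \<and> norm (adj x - y) < e \<and> (\<forall>z\<in>circle. cmod (cnj (g z) - h z) < e)"
    using laurent_adj[OF y(1)] by blast
qed

text \<open>The difference corresponds to the zero function, so its norm is at most 0.\<close>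

lemma calculus_unique:
  assumes "calculus x g" "calculus y g"
  shows "x = y"
  using calculus_norm_le[OF calculus_diff[OF assms], of 0] by simp

lemma calculus_unique_fun:
  assumes "calculus x g" "calculus x h" "z \<in> circle"
  shows "g z = h z"
  using calculus_le_norm[OF calculus_diff[OF assms(1,2)] assms(3)] by simp

lemma calculus_sum:
  assumes "\<And>i. i \<in> I \<Longrightarrow> calculus (x i) (g i)"
  shows "calculus (\<Sum>i\<in>I. x i) (\<lambda>z. \<Sum>i\<in>I. g i z)"
  using assms
proof (induction I rule: infinite_finite_induct)
  case (insert i I)
  then show ?case using calculus_add[of "x i" "g i"] by simp
qed (use calculus_const[of 0] in simp_all)

lemma calculus_power: "calculus x g \<Longrightarrow> calculus (x ^ n) (\<lambda>z. g z ^ n)"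
  by (induction n) (auto intro: calculus_one calculus_mult)

text \<open>The partial sums of the exponential series converge in norm at \<open>x\<close> and
  uniformly on the circle at \<open>g\<close>, because \<open>cmod (g z) \<le> norm x\<close> there;
  the relation is closed under such limits.\<close>

lemma calculus_exp:
  assumes "calculus x g"
  shows "calculus (exp x) (\<lambda>z. exp (g z))"
proof (rule calculus_limit)
  fix e :: real assume "e > 0"
  let ?S = "\<lambda>N y. \<Sum>n<N. y ^ n /\<^sub>R fact n"
  have "(\<lambda>N. ?S N x) \<longlonglongrightarrow> exp x"
    using exp_converges[of x] by (simp add: sums_def)
  then have 1: "\<forall>\<^sub>F N in sequentially. norm (exp x - ?S N x) < e"
    using \<open>e > 0\<close> by (simp add: tendsto_iff dist_norm norm_minus_commute)
  have "uniform_limit circle (\<lambda>N z. \<Sum>n<N. g z ^ n /\<^sub>R fact n) (\<lambda>z. \<Sum>n. g z ^ n /\<^sub>R fact n) sequentially"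
  proof (rule Weierstrass_m_test)
    show "norm (g z ^ n /\<^sub>R fact n) \<le> norm x ^ n /\<^sub>R fact n" if "z \<in> circle" for n z
      using calculus_le_norm[OF assms that] by (simp add: norm_power divide_right_mono power_mono field_simps)
    show "summable (\<lambda>n. norm x ^ n /\<^sub>R fact n)" by (rule summable_exp_generic)
  qed
  then have "\<forall>\<^sub>F N in sequentially. \<forall>z\<in>circle. cmod (exp (g z) - ?S N (g z)) < e"
    using \<open>e > 0\<close> by (simp add: uniform_limit_iff dist_norm norm_minus_commute exp_def)
  with 1 have "\<forall>\<^sub>F N in sequentially. norm (exp x - ?S N x) < e \<and>
      (\<forall>z\<in>circle. cmod (exp (g z) - ?S N (g z)) < e)"
    by eventually_elim simp
  from eventually_happens'[OF sequentially_bot this]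
  obtain N where "norm (exp x - ?S N x) < e" "\<forall>z\<in>circle. cmod (exp (g z) - ?S N (g z)) < e"
    by blast
  moreover have "calculus (?S N x) (\<lambda>z. ?S N (g z))"
    unfolding scaleR_scaleC scaleR_conv_of_real
    by (intro calculus_sum calculus_scaleC calculus_power assms)
  ultimately show "\<exists>y h. calculus y h \<and> norm (exp x - y) < e \<and> (\<forall>z\<in>circle. cmod (exp (g z) - h z) < e)"
    by blast
qed

lemma calculus_continuous:
  assumes "calculus x g"
  shows "continuous_on circle g"
proof -
  have "\<exists>h. continuous_on circle h \<and> (\<forall>z\<in>circle. cmod (g z - h z) < inverse (real (Suc n)))" for n
    using calculusE[OF assms, of "inverse (real (Suc n))"] laurent_continuous
    by (metis inverse_positive_iff_positive of_nat_0_less_iff zero_less_Suc)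
  then obtain H where H: "\<And>n. continuous_on circle (H n)"
      "\<And>n z. z \<in> circle \<Longrightarrow> cmod (g z - H n z) < inverse (real (Suc n))"
    by metis
  have H': "dist (H n z) (g z) < inverse (real (Suc n))" if "z \<in> circle" for n z
    using H(2)[OF that] by (simp add: dist_norm norm_minus_commute)
  have "uniform_limit circle H g sequentially"
    unfolding uniform_limit_iff
  proof (intro allI impI)
    fix e :: real assume "e > 0"
    from order_tendstoD(2)[OF LIMSEQ_inverse_real_of_nat this]
    show "\<forall>\<^sub>F n in sequentially. \<forall>z\<in>circle. dist (H n z) (g z) < e"
      by eventually_elim (use H' less_trans in blast)
  qed
  then show ?thesis
    by (rule uniform_limit_theorem[rotated]) (use H(1) in auto)
qed

text \<open>Laurent polynomials converging to \<open>x\<close> have functions that are uniformly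
  Cauchy on the circle, by \<open>laurent_le_norm\<close>; their uniform limit is the required
  function.\<close>

lemma calculus_exists_of_closure:
  assumes "x \<in> closure {y. \<exists>h. laurent u y h}"
  shows "\<exists>g. calculus x g"
proof -
  obtain Y where Y: "\<And>n. \<exists>h. laurent u (Y n) h" "Y \<longlonglongrightarrow> x"
    using assms unfolding closure_sequential by blast
  then obtain H where H: "\<And>n. laurent u (Y n) (H n)" by metis
  have "uniformly_Cauchy_on circle H"
    unfolding uniformly_Cauchy_on_def
  proof (intro allI impI)
    fix e :: real assume "e > 0"
    with LIMSEQ_imp_Cauchy[OF Y(2)] obtain M where
      "\<And>m n. m \<ge> M \<Longrightarrow> n \<ge> M \<Longrightarrow> norm (Y m - Y n) < e"
      unfolding Cauchy_iff by blast
    moreover have "cmod (H m z - H n z) \<le> norm (Y m - Y n)" if "z \<in> circle" for m n z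
      by (rule laurent_le_norm[OF laurent_diff[OF H H] that])
    ultimately show "\<exists>M. \<forall>z\<in>circle. \<forall>m\<ge>M. \<forall>n\<ge>M. dist (H m z) (H n z) < e"
      unfolding dist_norm by (metis le_less_trans)
  qed
  then obtain g where g: "uniform_limit circle H g sequentially"
    using Cauchy_uniformly_convergent uniformly_convergent_on_def by blast
  have "calculus x g"
  proof (rule calculus_limit)
    fix e :: real assume "e > 0"
    have "\<forall>\<^sub>F n in sequentially. norm (x - Y n) < e"
      using Y(2) \<open>e > 0\<close> by (simp add: tendsto_iff dist_norm norm_minus_commute)
    moreover have "\<forall>\<^sub>F n in sequentially. \<forall>z\<in>circle. cmod (g z - H n z) < e"
      using g \<open>e > 0\<close> by (simp add: uniform_limit_iff dist_norm norm_minus_commute)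
    ultimately have "\<forall>\<^sub>F n in sequentially. norm (x - Y n) < e \<and> (\<forall>z\<in>circle. cmod (g z - H n z) < e)"
      by eventually_elim simp
    from eventually_happens'[OF sequentially_bot this]
    obtain n where "norm (x - Y n) < e" "\<forall>z\<in>circle. cmod (g z - H n z) < e"
    by blast
    then show "\<exists>y h. calculus y h \<and> norm (x - y) < e \<and> (\<forall>z\<in>circle. cmod (g z - h z) < e)"
      using calculus_laurent[OF H] by blast
  qed
  then show ?thesis by blast
qed

text \<open>The converse passage: uniform Laurent approximations of \<open>g\<close> come from
  elements that are Cauchy by \<open>laurent_norm_le\<close>, and completeness supplies the
  limit.\<close>

lemma calculus_exists_of_continuous:
  assumes "continuous_on circle g"
  shows "\<exists>x. calculus x g"
proof -
  let ?e = "\<lambda>n. inverse (real (Suc n))"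
  have "\<exists>y h. laurent u y h \<and> (\<forall>z\<in>circle. cmod (g z - h z) < ?e n)" for n
    by (rule laurent_dense[OF assms]) simp
  then obtain Y H where H: "\<And>n. laurent u (Y n) (H n)" "\<And>n z. z \<in> circle \<Longrightarrow> cmod (g z - H n z) < ?e n"
    by metis
  have small: "\<forall>\<^sub>F n in sequentially. ?e n < e" if "e > 0" for e
    using order_tendstoD(2)[OF LIMSEQ_inverse_real_of_nat that] .
  have "Cauchy Y"
    unfolding Cauchy_iff
  proof (intro allI impI)
    fix e :: real assume "e > 0"
    then obtain M where M: "\<And>n. n \<ge> M \<Longrightarrow> ?e n < e / 3"
      using small[of "e / 3"] by (auto simp: eventually_sequentially)
    have "norm (Y m - Y n) \<le> 2 * e / 3" if "m \<ge> M" "n \<ge> M" for m n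
    proof (rule laurent_norm_le[OF laurent_diff[OF H(1) H(1)]])
      fix z :: complex assume "z \<in> circle"
      then show "cmod (H m z - H n z) \<le> 2 * e / 3"
        using H(2)[of z m] H(2)[of z n] M[OF that(1)] M[OF that(2)]
          norm_triangle_ineq4[of "g z - H n z" "g z - H m z"] by simp
    qed
    moreover have "2 * e / 3 < e" using \<open>e > 0\<close> by simp
    ultimately show "\<exists>M. \<forall>m\<ge>M. \<forall>n\<ge>M. norm (Y m - Y n) < e" by (meson le_less_trans)
  qed
  then obtain x where x: "Y \<longlonglongrightarrow> x" using Cauchy_convergent_iff convergent_def by blast
  have "calculus x g"
  proof (rule calculus_limit)
    fix e :: real assume "e > 0"
    have "\<forall>\<^sub>F n in sequentially. norm (x - Y n) < e"
      using x \<open>e > 0\<close> by (simp add: tendsto_iff dist_norm norm_minus_commute)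
    with small[OF \<open>e > 0\<close>] have "\<forall>\<^sub>F n in sequentially. ?e n < e \<and> norm (x - Y n) < e"
      by eventually_elim simp
    from eventually_happens'[OF sequentially_bot this]
    obtain n where "?e n < e" "norm (x - Y n) < e"
    by blast
    then show "\<exists>y h. calculus y h \<and> norm (x - y) < e \<and> (\<forall>z\<in>circle. cmod (g z - h z) < e)"
      using calculus_laurent[OF H(1)] H(2) less_trans by blast
  qed
  then show ?thesis by blast
qed

section \<open>Identification of the relation \<open>calculus\<close> with
  \<open>circle_calculus\<close>\<close>

lemma calculus_star_hom: "(\<lambda>g. THE x. calculus x g) \<in> star_hom C_circle whole"
proof -
  let ?\<Phi> = "\<lambda>g. THE x. calculus x g"
  have eq: "?\<Phi> g = x" if "calculus x g" for x g
    using that calculus_unique by blast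
  have \<Phi>: "calculus (?\<Phi> g) g" if "g \<in> carrier C_circle" for g
    using calculus_exists_of_continuous[of g] that eq by auto
  have r: "calculus x (restrict g circle)" if "calculus x g" for x g
    using that by (rule calculus_cong) simp
  have "?\<Phi> \<in> ring_hom C_circle whole"
  proof (rule ring_hom_memI)
    fix g h assume gh: "g \<in> carrier C_circle" "h \<in> carrier C_circle"
    show "?\<Phi> (g \<otimes>\<^bsub>C_circle\<^esub> h) = ?\<Phi> g \<otimes>\<^bsub>whole\<^esub> ?\<Phi> h"
      using eq[OF r[OF calculus_mult[OF \<Phi>[OF gh(1)] \<Phi>[OF gh(2)]]]] by simp
    show "?\<Phi> (g \<oplus>\<^bsub>C_circle\<^esub> h) = ?\<Phi> g \<oplus>\<^bsub>whole\<^esub> ?\<Phi> h"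
      using eq[OF r[OF calculus_add[OF \<Phi>[OF gh(1)] \<Phi>[OF gh(2)]]]] by simp
  qed (use eq[OF r[OF calculus_one]] in simp_all)
  moreover have "?\<Phi> (scl C_circle a g) = scl whole a (?\<Phi> g)" if "g \<in> carrier C_circle" for a g
    using eq[OF r[OF calculus_scaleC[OF \<Phi>[OF that]]]] by simp
  moreover have "?\<Phi> (star C_circle g) = star whole (?\<Phi> g)" if "g \<in> carrier C_circle" for g
    using eq[OF r[OF calculus_adj[OF \<Phi>[OF that]]]] by simp
  ultimately show ?thesis unfolding star_hom_def by blast
qed

text \<open>Any competing homomorphism agrees on Laurent polynomials and is bounded, hence agrees
  everywhere. This gives the uniqueness hidden in the definite description of
  \<open>circle_calculus\<close>.\<close>

lemma calculus_star_hom_eq: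
  assumes \<Psi>: "\<Psi> \<in> star_hom C_circle whole" and id: "\<Psi> (\<lambda>z\<in>circle. z) = u" and "calculus x g"
  shows "\<Psi> (restrict g circle) = x"
proof -
  have "norm (\<Psi> (restrict g circle) - x) \<le> 0"
  proof (rule field_le_epsilon)
    fix e :: real assume "e > 0"
    \<comment> \<open>The bound for \<open>\<Psi>\<close> doubles its share of the error, so the
      total is two thirds plus one third of \<open>e\<close>.\<close>
    then have e: "e / 3 > 0" by simp
    obtain y h where y: "laurent u y h" "norm (x - y) < e / 3"
        "\<And>z. z \<in> circle \<Longrightarrow> cmod (g z - h z) < e / 3"
      using calculusE[OF assms(3) e] by blast
    note c = calculus_continuous[OF assms(3)] laurent_continuous[OF y(1), of circle]
    have c': "continuous_on circle (\<lambda>z. g z - h z)" using c by (intro continuous_intros)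
    have "\<Psi> (restrict g circle) = \<Psi> (\<lambda>z\<in>circle. g z - h z) + \<Psi> (restrict h circle)"
      using star_hom_C_circle(1)[OF \<Psi> c' c(2)] by simp
    then have eq: "\<Psi> (restrict g circle) - x = \<Psi> (\<lambda>z\<in>circle. g z - h z) - (x - y)"
      using laurent_star_hom[OF \<Psi> id y(1)] by simp
    have "norm (\<Psi> (\<lambda>z\<in>circle. g z - h z)) \<le> 2 * (e / 3)"
      by (rule star_hom_C_circle_norm_le[OF \<Psi> e c']) (use y(3) in \<open>auto intro: less_imp_le\<close>)
    then show "norm (\<Psi> (restrict g circle) - x) \<le> 0 + e"
      unfolding eq using y(2) norm_triangle_ineq4[of "\<Psi> (\<lambda>z\<in>circle. g z - h z)" "x - y"] by linarith
  qed
  then show ?thesis by simp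
qed

lemma circle_calculus_eq:
  assumes "calculus x g"
  shows "circle_calculus u g = x"
  unfolding circle_calculus_def
proof (rule the_equality)
  let ?\<Phi> = "\<lambda>g. THE x. calculus x g"
  have "calculus u (\<lambda>z\<in>circle. z)"
    using calculus_laurent[OF laurent.gen] by (rule calculus_cong) simp
  then have id: "?\<Phi> (\<lambda>z\<in>circle. z) = u" using calculus_unique by blast
  then show "\<exists>\<Phi>\<in>star_hom C_circle whole. \<Phi> (\<lambda>z\<in>circle. z) = u \<and> \<Phi> (restrict g circle) = x"
    by (intro bexI[of _ ?\<Phi>] conjI calculus_star_hom id calculus_star_hom_eq[OF calculus_star_hom id assms])
qed (use calculus_star_hom_eq[OF _ _ assms] in blast)

end


section \<open>Logarithms of circle-valued functions\<close>

text \<open>The scalar counterpart of \<open>unitary_power\<close>, an integer power of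
  \<open>z\<close> only for \<open>z\<close> on the circle.\<close>

definition circle_power :: "complex \<Rightarrow> int \<Rightarrow> complex" where
  "circle_power z d = (if 0 \<le> d then z ^ nat d else cnj z ^ nat (- d))"

lemma circle_power_cis: "circle_power (cis t) d = cis (of_int d * t)"
proof (cases "0 \<le> d")
  case True
  then have "real (nat d) = of_int d" by simp
  then show ?thesis using True Complex.DeMoivre[of t "nat d"] by (simp add: circle_power_def)
next
  case False
  then have "real (nat (- d)) = - of_int d" by simp
  then show ?thesis using False Complex.DeMoivre[of "- t" "nat (- d)"] by (simp add: circle_power_def cis_cnj)
qed

text \<open>Along the parametrization \<open>E\<close> of the circle by \<open>[0, 1]\<close> a
  continuous logarithm exists. Its increment is the winding number \<open>d\<close>; after
  subtracting \<open>d * t\<close> the endpoint values agree and the function descends to the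
  circle.\<close>

lemma circle_logarithm:
  fixes g :: "complex \<Rightarrow> complex"
  assumes g: "continuous_on circle g" "\<And>z. z \<in> circle \<Longrightarrow> cmod (g z) = 1"
  shows "\<exists>(d::int) f. continuous_on circle f \<and> (\<forall>z\<in>circle. g z = cis (2 * pi * f z) * circle_power z d)"
proof -
  define E where "E = (\<lambda>t. cis (2 * pi * t))"
  have E: "continuous_on S E" "E t \<in> circle" for S t
    by (auto simp: E_def intro!: continuous_intros)
  have E_eq: "\<exists>t\<in>{0..<1}. z = E t" if "z \<in> circle" for z
  proof
    have "z = cis (Arg2pi z)" using that Arg2pi_eq[of z] by (simp add: cis_conv_exp mult.commute)
    then show "z = E (Arg2pi z / (2 * pi))" by (simp add: E_def)
    show "Arg2pi z / (2 * pi) \<in> {0..<1}"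
      using Arg2pi_ge_0[of z] Arg2pi_lt_2pi[of z] by simp
  qed
  have E_inj: "s = t" if "s \<in> {0..<1}" "t \<in> {0..<1}" "E s = E t" for s t
  proof -
    have "2 * pi * s = 2 * pi * t"
      using that Arg2pi_unique[of 1 "2 * pi * s" "E s"] Arg2pi_unique[of 1 "2 * pi * t" "E t"]
      by (simp add: E_def cis_conv_exp mult.commute)
    then show ?thesis by simp
  qed
  have "continuous_on {0..1} (\<lambda>t. g (E t))"
    by (rule continuous_on_compose2[OF g(1) E(1)]) (use E(2) in auto)
  moreover have "contractible {0..1::real}" by (intro convex_imp_contractible convex_closed_interval)
  moreover have "g (E t) \<noteq> 0" for t using g(2)[OF E(2), of t] by auto
  ultimately obtain h where h: "continuous_on {0..1::real} h" "\<And>t. t \<in> {0..1} \<Longrightarrow> g (E t) = exp (h t)"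
    using continuous_logarithm_on_contractible by metis
  define k where "k = (\<lambda>t. Im (h t) / (2 * pi))"
  have k: "g (E t) = cis (2 * pi * k t)" if "t \<in> {0..1}" for t
  proof -
    have "exp (Re (h t)) = 1" using g(2)[OF E(2), of t] h(2)[OF that] by simp
    then have "h t = \<i> * Im (h t)" by (simp add: complex_eq_iff)
    then have "exp (h t) = cis (Im (h t))" by (metis cis_conv_exp)
    then show ?thesis using h(2)[OF that] by (simp add: k_def)
  qed
  have "E 1 = E 0" by (simp add: E_def)
  then have "cis (2 * pi * k 1) = cis (2 * pi * k 0)" using k[of 0] k[of 1] by simp
  then have "cis (2 * pi * (k 1 - k 0)) = 1" by (simp add: right_diff_distrib flip: cis_divide)
  \<comment> \<open>The winding number of \<open>g\<close>.\<close>
  then obtain d :: int where "2 * pi * (k 1 - k 0) = 2 * pi * of_int d"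
    by (auto simp: complex_eq_iff cos_one_2pi_int mult_ac)
  then have d: "k 1 - k 0 = of_int d" by simp
  define F where "F = (\<lambda>t. k t - of_int d * t)"
  have F: "continuous_on {0..1} F"
    unfolding F_def k_def using h(1) by (intro continuous_intros) auto
  have F01: "F 1 = F 0" using d by (simp add: F_def)
  \<comment> \<open>The half-open interval makes the parameter of a point unique.\<close>
  define s where "s z = (SOME t. t \<in> {0..<1} \<and> z = E t)" for z
  have s: "s z \<in> {0..<1}" "z = E (s z)" if "z \<in> circle" for z
    using someI_ex[of "\<lambda>t. t \<in> {0..<1} \<and> z = E t"] E_eq[OF that] unfolding s_def by blast+
  define f where "f z = F (s z)" for z
  \<comment> \<open>The endpoint \<open>t = 1\<close> has chosen parameter \<open>0\<close>; here
    the equality of \<open>F\<close> at both ends enters.\<close>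
  have fE: "f (E t) = F t" if "t \<in> {0..1}" for t
  proof (cases "t = 1")
    case True
    have "s (E 0) = 0" using s[OF E(2)[of 0]] E_inj[of "s (E 0)" 0] by auto
    then show ?thesis using True F01 \<open>E 1 = E 0\<close> by (simp add: f_def)
  next
    case False
    then have "s (E t) = t" using s[OF E(2)[of t]] E_inj[of "s (E t)" t] that by auto
    then show ?thesis by (simp add: f_def)
  qed
  \<comment> \<open>\<open>E\<close> is a quotient map from a compact interval: the preimage of a
    closed set under \<open>f\<close> is the image under \<open>E\<close> of a compact set, hence
    closed.\<close>
  have "continuous_on circle f"
    unfolding continuous_on_closed_vimage[OF closed_sphere]
  proof (intro allI impI)
    fix B :: "real set" assume "closed B"
    then have "closed (F -` B \<inter> {0..1})"
      using F continuous_on_closed_vimage[of "{0..1}" F] by simp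
    then have "compact (F -` B \<inter> {0..1})"
      using compact_Int_closed[of "{0..1}" "F -` B \<inter> {0..1}"] by (simp add: Int_absorb1)
    then have "compact (E ` (F -` B \<inter> {0..1}))" by (rule compact_continuous_image[OF E(1)])
    moreover have "f -` B \<inter> circle = E ` (F -` B \<inter> {0..1})"
    proof
      show "E ` (F -` B \<inter> {0..1}) \<subseteq> f -` B \<inter> circle" using fE E(2) by auto
      show "f -` B \<inter> circle \<subseteq> E ` (F -` B \<inter> {0..1})"
      proof
        fix z assume "z \<in> f -` B \<inter> circle"
        then have z: "f z \<in> B" "z \<in> circle" by auto
        then have "s z \<in> F -` B \<inter> {0..1}" using s(1)[of z] by (auto simp: f_def)
        then show "z \<in> E ` (F -` B \<inter> {0..1})" using s(2)[OF z(2)] by blast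
      qed
    qed
    ultimately show "closed (f -` B \<inter> circle)" by (simp add: compact_imp_closed)
  qed
  moreover have "g z = cis (2 * pi * f z) * circle_power z d" if "z \<in> circle" for z
  proof -
    have t: "s z \<in> {0..1}" using s(1)[OF that] by auto
    have "g z = cis (2 * pi * k (s z))" using k[OF t] s(2)[OF that] by simp
    also have "2 * pi * k (s z) = 2 * pi * f z + of_int d * (2 * pi * s z)"
      by (simp add: f_def F_def algebra_simps)
    also have "cis \<dots> = cis (2 * pi * f z) * circle_power (E (s z)) d"
      by (simp add: circle_power_cis E_def cis_mult)
    finally show ?thesis using s(2)[OF that] by simp
  qed
  ultimately show ?thesis by blast
qed


section \<open>The commutant of \<open>u\<close>\<close>

lemma unitary_power_0 [simp]: "unitary_power x 0 = 1"
  by (simp add: unitary_power_def)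

lemma mult_unitary_power:
  assumes "x * adj x = 1"
  shows "x * unitary_power x b = unitary_power x (b + 1)"
proof (cases "0 \<le> b")
  case True
  then show ?thesis by (simp add: unitary_power_def nat_add_distrib)
next
  case False
  then obtain n where n: "b = - int (Suc n)"
    by (metis negD not_le)
  have "x * adj x ^ Suc n = adj x ^ n" by (simp add: assms flip: mult.assoc)
  then show ?thesis by (cases "n = 0") (simp_all add: n unitary_power_def nat_add_distrib)
qed

lemma adj_mult_unitary_power:
  assumes "adj x * x = 1"
  shows "adj x * unitary_power x b = unitary_power x (b - 1)"
proof (cases "0 < b")
  case True
  then obtain n where n: "b = int (Suc n)"
    by (metis gr0_implies_Suc pos_int_cases)
  have "adj x * x ^ Suc n = x ^ n" by (simp add: assms flip: mult.assoc)
  then show ?thesis by (simp add: n unitary_power_def nat_add_distrib)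
next
  case False
  then have "nat (1 - b) = Suc (nat (- b))" by linarith
  then show ?thesis using False by (cases "b = 0") (simp_all add: unitary_power_def)
qed

lemma closure_binary_closed:
  fixes S :: "'b::metric_space set" and F :: "'b \<Rightarrow> 'b \<Rightarrow> 'b"
  assumes "\<And>x y. x \<in> S \<Longrightarrow> y \<in> S \<Longrightarrow> F x y \<in> S"
    and "\<And>X Y x y. X \<longlonglongrightarrow> x \<Longrightarrow> Y \<longlonglongrightarrow> y \<Longrightarrow> (\<lambda>n. F (X n) (Y n)) \<longlonglongrightarrow> F x y"
    and "x \<in> closure S" "y \<in> closure S"
  shows "F x y \<in> closure S"
proof -
  obtain X Y where "\<And>n. X n \<in> S" "X \<longlonglongrightarrow> x" "\<And>n. Y n \<in> S" "Y \<longlonglongrightarrow> y"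
    using assms(3,4) unfolding closure_sequential by blast
  then have "\<And>n. F (X n) (Y n) \<in> S" "(\<lambda>n. F (X n) (Y n)) \<longlonglongrightarrow> F x y"
    using assms(1,2) by auto
  then show ?thesis
    unfolding closure_sequential by (intro exI[of _ "\<lambda>n. F (X n) (Y n)"]) simp
qed

context rotation_unitaries
begin

lemma calculus_unitary_power: "calculus (unitary_power u d) (\<lambda>z. circle_power z d)"
  using calculus_power[OF calculus_laurent[OF laurent.gen]]
    calculus_power[OF calculus_laurent[OF laurent.gen_adj]]
  by (simp add: unitary_power_def circle_power_def)

section \<open>Words in the generators, graded by their degree in \<open>v\<close>\<close>

lemma l_nonzero: "l \<noteq> 0"
  using l(1) by auto

lemma l_powi_eq_1: "l powi b = 1 \<longleftrightarrow> b = 0"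
proof (cases "0 \<le> b")
  case True
  then show ?thesis using l(2)[of "nat b"] by (cases "b = 0") (auto simp: power_int_def)
next
  case False
  then show ?thesis using l(2)[of "nat (- b)"] l_nonzero
    by (auto simp: power_int_def power_inverse)
qed

lemma v_adj_u: "v * adj u = inverse l *\<^sub>C (adj u * v)"
proof -
  have "adj u * v = adj u * (v * u) * adj u" by (simp add: u mult.assoc)
  also have "\<dots> = l *\<^sub>C ((adj u * u) * v * adj u)"
    by (simp add: vu scaleC_mult_left scaleC_mult_right mult.assoc)
  finally have "adj u * v = l *\<^sub>C (v * adj u)" by (simp add: u)
  then show ?thesis by (simp add: scaleC_scaleC l_nonzero)
qed

lemma adj_v_u: "adj v * u = inverse l *\<^sub>C (u * adj v)"
proof -
  have "u * adj v = adj v * (v * u) * adj v" by (simp add: mult.assoc[symmetric] v)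
  also have "\<dots> = l *\<^sub>C (adj v * u * (v * adj v))"
    by (simp add: vu scaleC_mult_left scaleC_mult_right mult.assoc)
  finally have "u * adj v = l *\<^sub>C (adj v * u)" by (simp add: v)
  then show ?thesis by (simp add: scaleC_scaleC l_nonzero)
qed

lemma adj_v_adj_u: "adj v * adj u = l *\<^sub>C (adj u * adj v)"
proof -
  have "adj (v * u) = adj (l *\<^sub>C (u * v))" by (simp only: vu)
  then have "adj u * adj v = cnj l *\<^sub>C (adj v * adj u)" by (simp add: adj_mult adj_scaleC)
  moreover have "l * cnj l = 1" using l(1) complex_norm_square[of l] by simp
  ultimately show ?thesis by (simp add: scaleC_scaleC)
qed

text \<open>The index is the total exponent of \<open>v\<close>, not determined by the element since
  \<open>0\<close> has every degree. Complex scalars are built in because \<open>span\<close> is the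
  real span, which thereby becomes a complex subspace.\<close>

inductive word :: "int \<Rightarrow> 'a \<Rightarrow> bool" where
  one: "word 0 1"
| scale: "word b x \<Longrightarrow> word b (c *\<^sub>C x)"
| mult_u: "word b x \<Longrightarrow> word b (u * x)"
| mult_adj_u: "word b x \<Longrightarrow> word b (adj u * x)"
| mult_v: "word b x \<Longrightarrow> word (b + 1) (v * x)"
| mult_adj_v: "word b x \<Longrightarrow> word (b - 1) (adj v * x)"

lemma word_mult:
  assumes "word b x" "word c y"
  shows "word (b + c) (x * y)"
  using assms
proof (induction rule: word.induct)
  case (mult_v b x)
  then show ?case using word.mult_v[of "b + c" "x * y"] by (simp add: mult.assoc algebra_simps)
next
  case (mult_adj_v b x)
  then show ?case using word.mult_adj_v[of "b + c" "x * y"] by (simp add: mult.assoc algebra_simps)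
qed (auto simp: mult.assoc scaleC_mult_left intro: word.intros)

lemma word_adj: "word b x \<Longrightarrow> word (- b) (adj x)"
proof (induction rule: word.induct)
  case (mult_u b x)
  then show ?case using word_mult[OF _ word.mult_adj_u[OF word.one]] by (fastforce simp: adj_mult)
next
  case (mult_adj_u b x)
  then show ?case using word_mult[OF _ word.mult_u[OF word.one]] by (fastforce simp: adj_mult adj_adj)
next
  case (mult_v b x)
  then show ?case using word_mult[OF _ word.mult_adj_v[OF word.one]] by (fastforce simp: adj_mult)
next
  case (mult_adj_v b x)
  then show ?case using word_mult[OF _ word.mult_v[OF word.one]] by (fastforce simp: adj_mult adj_adj)
qed (auto simp: adj_scaleC intro: word.intros)

text \<open>Each \<open>v\<close> moved past \<open>u\<close> contributes \<open>l\<close> and each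
  \<open>adj v\<close> contributes \<open>inverse l\<close>, while powers of \<open>u\<close>
  contribute nothing; the degree is thus visible as an eigenvalue of conjugation by
  \<open>u\<close>.\<close>

lemma word_u: "word b x \<Longrightarrow> x * u = l powi b *\<^sub>C (u * x)"
proof (induction rule: word.induct)
  case (scale b x c)
  then show ?case by (simp add: scaleC_mult_left scaleC_mult_right scaleC_scaleC mult.commute)
next
  case (mult_u b x)
  then show ?case by (simp add: mult.assoc scaleC_mult_right)
next
  case (mult_adj_u b x)
  have "adj u * x * u = l powi b *\<^sub>C ((adj u * u) * x)"
    by (simp only: mult.assoc mult_adj_u.IH scaleC_mult_right)
  then show ?case by (simp add: u flip: mult.assoc)
next
  case (mult_v b x)
  have "v * x * u = l powi b *\<^sub>C ((v * u) * x)"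
    by (simp only: mult.assoc mult_v.IH scaleC_mult_right)
  then show ?case
    by (simp add: vu scaleC_mult_left scaleC_scaleC power_int_add l_nonzero mult.assoc)
next
  case (mult_adj_v b x)
  have "adj v * x * u = l powi b *\<^sub>C ((adj v * u) * x)"
    by (simp only: mult.assoc mult_adj_v.IH scaleC_mult_right)
  then show ?case
    by (simp add: adj_v_u scaleC_mult_left scaleC_scaleC power_int_diff l_nonzero mult.assoc divide_inverse)
qed simp

text \<open>A normal form with the powers of \<open>v\<close> collected on the right. In degree 0 it
  shows that the word is a Laurent polynomial in \<open>u\<close>.\<close>

lemma word_laurent: "word b x \<Longrightarrow> \<exists>y h. laurent u y h \<and> x = y * unitary_power v b"
proof (induction rule: word.induct)
  case one
  show ?case using laurent_one by force
next
  case (scale b x c)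
  then show ?case using laurent_scaleC scaleC_mult_left by metis
next
  case (mult_u b x)
  then show ?case using laurent.mult[OF laurent.gen] mult.assoc by metis
next
  case (mult_adj_u b x)
  then show ?case using laurent.mult[OF laurent.gen_adj] mult.assoc by metis
next
  case (mult_v b x)
  then obtain y h where y: "laurent u y h" "x = y * unitary_power v b" by blast
  obtain y' h' where y': "laurent u y' h'" "v * y = y' * v"
    using laurent_conjugate[OF y(1) v(2,1) vu v_adj_u] by blast
  have "v * x = y' * (v * unitary_power v b)"
    unfolding y(2) by (simp add: y'(2) flip: mult.assoc)
  then show ?case using y'(1) mult_unitary_power[OF v(2), of b] by auto
next
  case (mult_adj_v b x)
  then obtain y h where y: "laurent u y h" "x = y * unitary_power v b" by blast
  obtain y' h' where y': "laurent u y' h'" "adj v * y = y' * adj v"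
    using laurent_conjugate[OF y(1) _ _ adj_v_u adj_v_adj_u] v unfolding adj_adj by blast
  have "adj v * x = y' * (adj v * unitary_power v b)"
    unfolding y(2) by (simp add: y'(2) flip: mult.assoc)
  then show ?case using y'(1) adj_mult_unitary_power[OF v(1), of b] by auto
qed

definition words :: "'a set" where
  "words = {x. \<exists>b. word b x}"

lemma span_words_closed:
  assumes "x \<in> span words"
  shows "y \<in> span words \<Longrightarrow> x * y \<in> span words" "c *\<^sub>C x \<in> span words" "adj x \<in> span words"
proof -
  have *: "a * y \<in> span words" if "a \<in> words" "y \<in> span words" for a y
    using that(2)
  proof (induction rule: span_induct_alt)
    case base
    then show ?case by (simp add: span_zero)
  next
    case (step r z w)
    have "a * z \<in> words" using that(1) step(1) word_mult unfolding words_def by blast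
    then show ?case
      using step(2) by (simp add: ring_distribs span_add span_scale span_base)
  qed
  show "x * y \<in> span words" if "y \<in> span words"
    using assms
  proof (induction rule: span_induct_alt)
    case base
    then show ?case by (simp add: span_zero)
  next
    case (step r z w)
    then show ?case using *[OF _ that] by (simp add: ring_distribs span_add span_scale)
  qed
  show "c *\<^sub>C x \<in> span words"
    using assms
  proof (induction rule: span_induct_alt)
    case base
    then show ?case by (simp add: span_zero)
  next
    case (step r z w)
    have "c *\<^sub>C z \<in> words" using step(1) word.scale unfolding words_def by blast
    moreover have "c *\<^sub>C r *\<^sub>R z = r *\<^sub>R c *\<^sub>C z" by (simp add: scaleR_scaleC scaleC_scaleC mult.commute)
    ultimately show ?case using step(2) by (simp add: scaleC_add_right span_add span_scale span_base)
  qed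
  show "adj x \<in> span words"
    using assms
  proof (induction rule: span_induct_alt)
    case base
    then show ?case by (simp add: span_zero)
  next
    case (step r z w)
    have "adj z \<in> words" using step(1) word_adj unfolding words_def by blast
    moreover have "adj (r *\<^sub>R z) = r *\<^sub>R adj z" by (simp add: scaleR_scaleC adj_scaleC)
    ultimately show ?case using step(2) by (simp add: adj_add span_add span_scale span_base)
  qed
qed

lemma continuous_scaleC: "continuous_on S (\<lambda>x::'a. c *\<^sub>C x)"
proof -
  have "continuous_on S (\<lambda>x::'a. (c *\<^sub>C 1) * x)" by (intro continuous_intros)
  then show ?thesis by (simp add: scaleC_mult_left)
qed

lemma continuous_adj: "continuous_on S (adj :: 'a \<Rightarrow> 'a)"
  unfolding continuous_on_iff dist_norm by (metis adj_diff norm_adj)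

text \<open>Makes the span of words dense as soon as \<open>u\<close> and \<open>v\<close> generate
  the algebra.\<close>

lemma cstar_subalgebra_words: "cstar_subalgebra (closure (span words))"
  unfolding cstar_subalgebra_def
proof (intro conjI ballI allI)
  show "1 \<in> closure (span words)"
    using word.one span_base[of 1 words] closure_subset unfolding words_def by blast
  fix x y assume x: "x \<in> closure (span words)"
  have "(\<lambda>x. c *\<^sub>C x) ` closure (span words) \<subseteq> closure (span words)" for c
    by (rule image_closure_subset[OF continuous_scaleC closed_closure])
      (use span_words_closed(2) closure_subset in blast)
  then show "c *\<^sub>C x \<in> closure (span words)" for c using x by blast
  have "adj ` closure (span words) \<subseteq> closure (span words)"
    by (rule image_closure_subset[OF continuous_adj closed_closure])
      (use span_words_closed(3) closure_subset in blast)
  then show "adj x \<in> closure (span words)" using x by blast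
  assume y: "y \<in> closure (span words)"
  show "x + y \<in> closure (span words)"
    by (rule closure_binary_closed[where F = "(+)", OF span_add tendsto_add x y])
  show "x * y \<in> closure (span words)"
    by (rule closure_binary_closed[where F = "(*)", OF span_words_closed(1) tendsto_mult x y])
qed simp

definition conjugate_average :: "'a \<Rightarrow> nat \<Rightarrow> 'a" where
  "conjugate_average x = average (\<lambda>n. adj u ^ n * x * u ^ n)"

lemma conjugate_average_word:
  assumes "word b x"
  shows "conjugate_average x \<longlonglongrightarrow> (if b = 0 then x else 0)"
proof -
  have "adj u ^ n * x * u ^ n = (l powi b) ^ n *\<^sub>C x" for n
  proof -
    have "x * u ^ n = (l powi b) ^ n *\<^sub>C (u ^ n * x)" for n
    proof (induction n)
      case (Suc n)
      have "x * u ^ Suc n = (x * u) * u ^ n" by (simp add: mult.assoc)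
      also have "\<dots> = l powi b *\<^sub>C (u * (x * u ^ n))"
        by (simp add: word_u[OF assms] scaleC_mult_left mult.assoc)
      finally show ?case by (simp add: Suc scaleC_mult_right scaleC_scaleC mult.assoc)
    qed simp
    then have "adj u ^ n * x * u ^ n = (l powi b) ^ n *\<^sub>C ((adj u ^ n * u ^ n) * x)"
      by (simp add: mult.assoc scaleC_mult_right)
    then show ?thesis by (simp add: left_right_inverse_power[OF u(1)])
  qed
  then show ?thesis
    using average_powers_scaleC[of "l powi b" x] l(1)
    by (simp add: conjugate_average_def norm_power_int l_powi_eq_1)
qed

text \<open>The limit keeps exactly the summands whose chosen degree is 0, and these are Laurent
  polynomials by the normal form.\<close>

lemma conjugate_average_span:
  assumes "x \<in> span words"
  shows "\<exists>y h. laurent u y h \<and> conjugate_average x \<longlonglongrightarrow> y"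
  using assms
proof (induction rule: span_induct_alt)
  case base
  have "conjugate_average 0 \<longlonglongrightarrow> 0"
    by (simp add: conjugate_average_def average_def[abs_def])
  then show ?case using laurent.const[of u 0] by auto
next
  case (step r x y)
  then obtain y' h' where y': "laurent u y' h'" "conjugate_average y \<longlonglongrightarrow> y'" by blast
  obtain b where b: "word b x" using step(1) unfolding words_def by blast
  have "\<exists>h. laurent u (if b = 0 then x else 0) h"
    using word_laurent[OF b] laurent.const[of u 0] by (cases "b = 0") auto
  then obtain h where h: "laurent u (if b = 0 then x else 0) h" by blast
  have "conjugate_average (r *\<^sub>R x + y) = (\<lambda>N. r *\<^sub>R conjugate_average x N + conjugate_average y N)"
    by (rule ext) (simp add: conjugate_average_def ring_distribs average_add average_scaleR)
  moreover have "(\<lambda>N. r *\<^sub>R conjugate_average x N + conjugate_average y N)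
      \<longlonglongrightarrow> r *\<^sub>R (if b = 0 then x else 0) + y'"
    by (intro tendsto_intros conjugate_average_word[OF b] y'(2))
  moreover have "laurent u (r *\<^sub>R (if b = 0 then x else 0) + y') (\<lambda>z. complex_of_real r * h z + h' z)"
    unfolding scaleR_scaleC by (intro laurent.add laurent_scaleC h y'(1))
  ultimately show ?case by auto
qed

text \<open>The average of \<open>u\<^sup>-\<^sup>n x u\<^sup>n\<close> fixes the commutant of \<open>u\<close> and, \<open>l\<close> not being a root of unity,
  sends \<open>y v\<^sup>b\<close> to \<open>0\<close> unless \<open>b = 0\<close>.\<close>

lemma commutant_u:
  assumes x: "x \<in> closure (span words)" and comm: "x * u = u * x"
  shows "x \<in> closure {y. \<exists>h. laurent u y h}"
  unfolding closure_approachable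
proof (intro allI impI)
  fix e :: real assume "e > 0"
  then obtain y where y: "y \<in> span words" "dist y x < e / 2"
    using x unfolding closure_approachable by (metis half_gt_zero)
  obtain y' h' where y': "laurent u y' h'" "conjugate_average y \<longlonglongrightarrow> y'"
    using conjugate_average_span[OF y(1)] by blast
  have "adj u ^ n * x * u ^ n = x" for n
  proof -
    have "x * u ^ n = u ^ n * x" using power_commuting_commutes[of u x n] comm by simp
    then have "adj u ^ n * x * u ^ n = (adj u ^ n * u ^ n) * x" by (simp add: mult.assoc)
    then show ?thesis by (simp add: left_right_inverse_power[OF u(1)])
  qed
  then have x_avg: "conjugate_average x N = x" if "N > 0" for N
    using that by (simp add: conjugate_average_def average_const)
  \<comment> \<open>Averaging conjugates by unitaries does not increase the norm, so an
    approximation of \<open>x\<close> keeps its quality.\<close>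
  have le: "norm (conjugate_average y N - conjugate_average x N) \<le> e / 2" for N
  proof -
    have "conjugate_average y N - conjugate_average x N = average (\<lambda>n. adj u ^ n * (y - x) * u ^ n) N"
      by (simp add: conjugate_average_def average_diff[symmetric] algebra_simps)
    moreover have "norm (average (\<lambda>n. adj u ^ n * (y - x) * u ^ n) N) \<le> e / 2"
    proof (rule norm_average_le)
      fix n
      have "norm (adj u ^ n * (y - x) * u ^ n) = norm (y - x)"
        by (subst norm_mult_unitary) (simp_all add: norm_unitary_mult adj_power adj_adj left_right_inverse_power u)
      then show "norm (adj u ^ n * (y - x) * u ^ n) \<le> e / 2" using y(2) by (simp add: dist_norm)
    qed (use \<open>e > 0\<close> in simp)
    ultimately show ?thesis by simp
  qed
  \<comment> \<open>The limit only preserves the weak inequality, hence the choice of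
    \<open>e / 2\<close> above.\<close>
  have "norm (y' - x) \<le> e / 2"
  proof (rule tendsto_upperbound)
    show "(\<lambda>N. norm (conjugate_average y N - x)) \<longlonglongrightarrow> norm (y' - x)"
      by (intro tendsto_intros y'(2))
    show "\<forall>\<^sub>F N in sequentially. norm (conjugate_average y N - x) \<le> e / 2"
      using eventually_gt_at_top[of 0] by eventually_elim (use le x_avg in metis)
  qed simp
  then have "dist y' x < e" using \<open>e > 0\<close> by (simp add: dist_norm)
  then show "\<exists>y\<in>{y. \<exists>h. laurent u y h}. dist y x < e" using y'(1) by blast
qed

text \<open>Such a \<open>w\<close> lies in the closed algebra of Laurent polynomials, so
  \<open>w = g(u)\<close>. The equation \<open>adj w * w = 1\<close> forces \<open>g\<close> to have
  modulus 1, and the circle logarithm of \<open>g\<close> transfers back through the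
  calculus.\<close>

lemma unitary_commuting_with_u:
  assumes gen: "cstar_subalgebra hull {u, v} = (UNIV :: 'a set)"
    and w: "adj w * w = 1" "w * u = u * w"
  shows "\<exists>d f. continuous_on circle f \<and>
    w = exp ((2 * pi * \<i>) *\<^sub>C circle_calculus u (\<lambda>z. complex_of_real (f z))) * unitary_power u d"
proof -
  have "u \<in> words" "v \<in> words"
    using word.mult_u[OF word.one] word.mult_v[OF word.one] unfolding words_def by auto
  then have "{u, v} \<subseteq> closure (span words)"
    using span_base[of _ words] closure_subset by blast
  then have "cstar_subalgebra hull {u, v} \<subseteq> closure (span words)"
    using cstar_subalgebra_words by (rule hull_minimal)
  then have "w \<in> closure (span words)" using gen by blast
  from calculus_exists_of_closure[OF commutant_u[OF this w(2)]]
  obtain g where g: "calculus w g" by blast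
  have "cmod (g z) = 1" if "z \<in> circle" for z
  proof -
    have "cnj (g z) * g z = 1"
      using calculus_unique_fun[OF calculus_mult[OF calculus_adj[OF g] g] _ that] calculus_one w(1) by simp
    then have "(cmod (g z))\<^sup>2 = 1"
      by (metis complex_norm_square mult.commute of_real_eq_1_iff)
    then show ?thesis by (simp add: power2_eq_1_iff) (use norm_ge_zero[of "g z"] in linarith)
  qed
  from circle_logarithm[OF calculus_continuous[OF g] this]
  obtain d f where f: "continuous_on circle f"
    and gf: "\<And>z. z \<in> circle \<Longrightarrow> g z = cis (2 * pi * f z) * circle_power z d" by blast
  have "continuous_on circle (\<lambda>z. complex_of_real (f z))" using f by (intro continuous_intros)
  then obtain x where x: "calculus x (\<lambda>z. complex_of_real (f z))"
    using calculus_exists_of_continuous by blast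
  have "calculus (exp ((2 * pi * \<i>) *\<^sub>C x) * unitary_power u d)
      (\<lambda>z. exp ((2 * pi * \<i>) * complex_of_real (f z)) * circle_power z d)"
    by (intro calculus_mult calculus_exp calculus_scaleC x calculus_unitary_power)
  then have "calculus (exp ((2 * pi * \<i>) *\<^sub>C x) * unitary_power u d) g"
    by (rule calculus_cong) (simp add: gf cis_conv_exp mult_ac)
  then have "w = exp ((2 * pi * \<i>) *\<^sub>C x) * unitary_power u d"
    using calculus_unique g by blast
  then show ?thesis using f circle_calculus_eq[OF x] by blast
qed

end

section \<open>Determination of automorphisms by their values on the generators, and the unitary
  \<open>\<alpha> v * adj v\<close>\<close>

theorem proposition1p6:
  fixes u v :: "'a::cstar_algebra" and \<theta> \<gamma> :: real and \<alpha> :: "'a \<Rightarrow> 'a"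
  assumes "rotation_algebra \<theta> u v"
    and "\<theta> \<notin> \<rat>"
    and "cstar_automorphism \<alpha>"
    and "\<alpha> u = exp (2 * pi * \<i> * \<gamma>) *\<^sub>C u"
  shows "\<exists>(d::int) (f::complex \<Rightarrow> real). continuous_on circle f \<and>
           \<alpha> = rotation_automorphism u v \<gamma> d f"
proof -
  let ?l = "exp (2 * pi * \<i> * \<theta>)" and ?c = "exp (2 * pi * \<i> * \<gamma>)"
  have uni: "adj u * u = 1" "u * adj u = 1" "adj v * v = 1" "v * adj v = 1"
    and vu: "v * u = ?l *\<^sub>C (u * v)" and gen: "cstar_subalgebra hull {u, v} = (UNIV :: 'a set)"
    using assms(1) by (auto simp: rotation_algebra_def rotation_pair_def unitary_in_def)
  \<comment> \<open>A root of unity would give \<open>n * \<theta> = k\<close> for an integer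
    \<open>k\<close>, making \<open>\<theta>\<close> rational.\<close>
  have "?l ^ n \<noteq> 1" if "n > 0" for n
  proof
    assume "?l ^ n = 1"
    then have "exp (of_nat n * (2 * pi * \<i> * \<theta>)) = 1" by (simp add: exp_of_nat_mult)
    then obtain k :: int where "of_nat n * (2 * pi * \<theta>) = of_int (2 * k) * pi"
      by (auto simp: exp_eq_1)
    then have "\<theta> = of_int k / of_nat n" using that by (simp add: field_simps)
    then show False using assms(2) by simp
  qed
  then interpret rotation_unitaries u v ?l
    using uni vu by unfold_locales auto
  have hom: "\<beta> x * \<beta> y = \<beta> (x * y)" "\<beta> 1 = 1" "\<beta> (c *\<^sub>C x) = c *\<^sub>C \<beta> x" "\<beta> (adj x) = adj (\<beta> x)"
    if "cstar_automorphism \<beta>" for \<beta> :: "'a \<Rightarrow> 'a" and c x y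
    using that ring_hom_mult[of \<beta> "whole :: 'a cstar_struct" "whole :: 'a cstar_struct"]
      ring_hom_one[of \<beta> "whole :: 'a cstar_struct" "whole :: 'a cstar_struct"]
    by (auto simp: cstar_automorphism_def star_hom_def)
  have pair: "rotation_pair \<theta> whole (\<beta> u) (\<beta> v)" if "cstar_automorphism \<beta>" for \<beta> :: "'a \<Rightarrow> 'a"
    unfolding rotation_pair_def unitary_in_def
    by (simp add: hom(4)[OF that, symmetric] hom(1)[OF that] hom(3)[OF that, symmetric] uni vu hom(2)[OF that])
  \<comment> \<open>The images of \<open>u\<close> and \<open>v\<close> form a rotation pair in the
    algebra itself, so the universal property with target \<open>whole\<close> applies.\<close>
  have unique: "\<beta> = \<beta>'" if "cstar_automorphism \<beta>" "cstar_automorphism \<beta>'" "\<beta> u = \<beta>' u" "\<beta> v = \<beta>' v" for \<beta> \<beta>'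
    using assms(1) pair[OF that(1)] that cstar_structure_whole
    unfolding rotation_algebra_def cstar_automorphism_def by metis
  let ?w = "\<alpha> v * adj v"
  note \<alpha> = hom[OF assms(3)]
  \<comment> \<open>Moving \<open>u\<close> past \<open>adj v\<close> gives
    \<open>inverse ?l\<close> and past \<open>\<alpha> v\<close> gives \<open>?l\<close>, since
    \<open>\<alpha>\<close> preserves the relation and only rescales \<open>u\<close>; the factors
    cancel.\<close>
  have "?w * u = \<alpha> v * (inverse ?l *\<^sub>C (u * adj v))"
    by (simp only: mult.assoc adj_v_u)
  also have "\<dots> = inverse ?l *\<^sub>C (\<alpha> v * u * adj v)"
    by (simp add: scaleC_mult_right mult.assoc)
  also have "\<alpha> v * u = ?l *\<^sub>C (u * \<alpha> v)"
  proof -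
    have "\<alpha> v * \<alpha> u = ?l *\<^sub>C (\<alpha> u * \<alpha> v)" by (simp add: \<alpha> vu)
    then have "?c *\<^sub>C (\<alpha> v * u) = ?c *\<^sub>C (?l *\<^sub>C (u * \<alpha> v))"
      by (simp add: assms(4) scaleC_mult_left scaleC_mult_right scaleC_scaleC mult.commute)
    \<comment> \<open>The nonzero scalar \<open>?c\<close> coming from \<open>\<alpha> u\<close> is
      cancelled.\<close>
    then have "inverse ?c *\<^sub>C ?c *\<^sub>C (\<alpha> v * u) = inverse ?c *\<^sub>C ?c *\<^sub>C (?l *\<^sub>C (u * \<alpha> v))"
      by (rule arg_cong)
    then show ?thesis unfolding scaleC_scaleC[of "inverse ?c"] by simp
  qed
  finally have comm: "?w * u = u * ?w"
    by (simp add: scaleC_mult_left scaleC_scaleC mult.assoc)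
  have "adj ?w * ?w = v * (\<alpha> (adj v * v)) * adj v"
    by (simp add: adj_mult adj_adj mult.assoc \<alpha>(1)[symmetric] \<alpha>(4))
  then have "adj ?w * ?w = 1" by (simp add: uni \<alpha>(2))
  from unitary_commuting_with_u[OF gen this comm]
  obtain d f where f: "continuous_on circle f" and
    w: "?w = exp ((2 * pi * \<i>) *\<^sub>C circle_calculus u (\<lambda>z. complex_of_real (f z))) * unitary_power u d"
    by blast
  have "\<alpha> v = ?w * v" by (simp add: mult.assoc uni)
  then have \<alpha>v: "\<alpha> v = exp ((2 * pi * \<i>) *\<^sub>C circle_calculus u (\<lambda>z. complex_of_real (f z)))
      * unitary_power u d * v"
    by (simp only: w)
  \<comment> \<open>\<open>\<alpha>\<close> itself witnesses existence for the definite description,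
    and \<open>unique\<close> excludes any other candidate.\<close>
  have "rotation_automorphism u v \<gamma> d f = \<alpha>"
    unfolding rotation_automorphism_def
    by (rule the_equality) (use assms(3,4) \<alpha>v unique in auto)
  then show ?thesis using f by blast
qed

end
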